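(* Let $\alpha$ be a composition with $n$ parts and $\sigma\in S_n$. Suppose that for some $j\in\{1,\dots,n-1\}$ we have $\alpha_j=\alpha_{j+1}$ and $\{\sigma_j,\sigma_{j+1}\}=\{i,i+1\}$ for some $i$. Then $\mathrm{E}^\sigma_\alpha(\mathbf{x};q,t)$ is symmetric in $x_i$ and $x_{i+1}$.
   Context: Permuted-basement Macdonald polynomials: compositions are $\alpha\in\mathbb{Z}_{\ge0}^n$, permutations in one-line notation $(\sigma_1,\dots,\sigma_n)$. The augmented diagram of shape $\alpha$ has rows $r=1,\dots,n$ top to bottom, columns numbered from $0$; row $r$ consists of basement box $(r,0)$ and boxes $(r,c)$, $1\le c\le\alpha_r$. An augmented filling with basement $\sigma$ is a map $F$ from all boxes to $\{1,\dots,n\}$ with $F(r,0)=\sigma_r$; non-attacking means no two distinct boxes with equal entries lie in the same column, or in columns $c-1$ and $c$ with the box in column $c$ strictly lower than the one in column $c-1$; $\mathrm{NAF}_\sigma(\alpha)$ is the set of these. For non-basement $u=(r,c)$: $d(u)=(r,c-1)$, $\mathrm{leg}(u)=\alpha_r-c$, $\mathrm{arm}(u)=|\{r'>r:c\le\alpha_{r'}\le\alpha_r\}|+|\{r'<r:c-1\le\alpha_{r'}<\alpha_r\}|$; $u$ is a descent if $F(d(u))<F(u)$; $\mathrm{maj}(F)=\sum_{\text{descents}}(\mathrm{leg}(u)+1)$. Type A triple: $a=(r,c-1),b=(r,c),e=(r',c)$, $c\ge1$, $r'>r$, $c\le\alpha_{r'}\le\alpha_r$; type B: $a=(r,c-1),b=(r,c),e=(r',c-1)$,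 $c\ge1$, $r'<r$, $c-1\le\alpha_{r'}<\alpha_r$. Ordering by entries with ties broken $a>e>b$, a triple is an inversion triple if $b<a<e$, $a<e<b$ or $e<b<a$; $\mathrm{coinv}(F)$ counts triples of type A or B that are not inversion triples. With $\mathbf{x}^F=\prod_{u\text{ non-basement}}x_{F(u)}$, $\mathrm{E}^\sigma_\alpha(\mathbf{x};q,t)=\sum_{F\in\mathrm{NAF}_\sigma(\alpha)}\mathbf{x}^Fq^{\mathrm{maj}F}t^{\mathrm{coinv}F}\prod_{u\text{ non-basement},\,F(u)\ne F(d(u))}\frac{1-t}{1-q^{1+\mathrm{leg}(u)}t^{1+\mathrm{arm}(u)}}$. *)

theory Defs
  imports Main
begin

text \<open>Conventions. A composition with n parts is a list al of naturals of length n;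
  part r (1-based, r = 1..n) is al ! (r - 1). A permutation sigma in S_n is a list of
  length n with distinct entries forming {1..n}; sigma_r = sigma ! (r - 1).
  Boxes are pairs (r, c) of row r (1..n, top to bottom) and column c.
  A filling is a function on pairs; to make the set of fillings finite we
  require it to be 0 outside the augmented diagram.\<close>

definition part :: "nat list \<Rightarrow> nat \<Rightarrow> nat" where
  "part al r = al ! (r - 1)"

definition aug_boxes :: "nat list \<Rightarrow> (nat \<times> nat) set" where
  "aug_boxes al = {(r, c). 1 \<le> r \<and> r \<le> length al \<and> c \<le> part al r}"

definition nb_boxes :: "nat list \<Rightarrow> (nat \<times> nat) set" where
  "nb_boxes al = {(r, c). 1 \<le> r \<and> r \<le> length al \<and> 1 \<le> c \<and> c \<le> part al r}"

definition non_attacking :: "nat list \<Rightarrow> (nat \<times> nat \<Rightarrow> nat) \<Rightarrow> bool" where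
  "non_attacking al F \<longleftrightarrow>
     (\<forall>r c r' c'. (r, c) \<in> aug_boxes al \<longrightarrow> (r', c') \<in> aug_boxes al \<longrightarrow>
        (r, c) \<noteq> (r', c') \<longrightarrow> F (r, c) = F (r', c') \<longrightarrow>
        c \<noteq> c' \<and> \<not> (c' = c + 1 \<and> r < r'))"

definition NAF :: "nat list \<Rightarrow> nat list \<Rightarrow> (nat \<times> nat \<Rightarrow> nat) set" where
  "NAF sigma al = {F.
     (\<forall>u \<in> aug_boxes al. F u \<in> {1..length al}) \<and>
     (\<forall>u. u \<notin> aug_boxes al \<longrightarrow> F u = 0) \<and>
     (\<forall>r \<in> {1..length al}. F (r, 0) = sigma ! (r - 1)) \<and>
     non_attacking al F}"

definition leg :: "nat list \<Rightarrow> nat \<times> nat \<Rightarrow> nat" where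
  "leg al u = part al (fst u) - snd u"

definition arm :: "nat list \<Rightarrow> nat \<times> nat \<Rightarrow> nat" where
  "arm al u = (case u of (r, c) \<Rightarrow>
     card {r'. r < r' \<and> r' \<le> length al \<and> c \<le> part al r' \<and> part al r' \<le> part al r}
   + card {r'. 1 \<le> r' \<and> r' < r \<and> c - 1 \<le> part al r' \<and> part al r' < part al r})"

definition is_descent :: "(nat \<times> nat \<Rightarrow> nat) \<Rightarrow> nat \<times> nat \<Rightarrow> bool" where
  "is_descent F u \<longleftrightarrow> F (fst u, snd u - 1) < F u"

definition maj :: "nat list \<Rightarrow> (nat \<times> nat \<Rightarrow> nat) \<Rightarrow> nat" where
  "maj al F = (\<Sum>u \<in> {u \<in> nb_boxes al. is_descent F u}. leg al u + 1)"

text \<open>Order on the entries of a triple with ties broken a > e > b: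
  a value v of a box is paired with a rank (a: 2, e: 1, b: 0) and compared lexicographically.\<close>

definition tlt :: "nat \<times> nat \<Rightarrow> nat \<times> nat \<Rightarrow> bool" where
  "tlt x y \<longleftrightarrow> fst x < fst y \<or> (fst x = fst y \<and> snd x < snd y)"

definition is_inversion_triple :: "nat \<Rightarrow> nat \<Rightarrow> nat \<Rightarrow> bool" where
  "is_inversion_triple a b e \<longleftrightarrow>
     (let A = (a, 2::nat); B = (b, 0::nat); E = (e, 1::nat) in
       (tlt B A \<and> tlt A E) \<or> (tlt A E \<and> tlt E B) \<or> (tlt E B \<and> tlt B A))"

text \<open>Type A triples indexed by (r, c, r'): a=(r,c-1), b=(r,c), e=(r',c).\<close>
definition typeA :: "nat list \<Rightarrow> (nat \<times> nat \<times> nat) set" where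
  "typeA al = {(r, c, r'). 1 \<le> r \<and> 1 \<le> c \<and> r < r' \<and> r' \<le> length al \<and>
                 c \<le> part al r' \<and> part al r' \<le> part al r}"

text \<open>Type B triples indexed by (r, c, r'): a=(r,c-1), b=(r,c), e=(r',c-1).\<close>
definition typeB :: "nat list \<Rightarrow> (nat \<times> nat \<times> nat) set" where
  "typeB al = {(r, c, r'). 1 \<le> r' \<and> r' < r \<and> r \<le> length al \<and> 1 \<le> c \<and>
                 c - 1 \<le> part al r' \<and> part al r' < part al r}"

definition coinv :: "nat list \<Rightarrow> (nat \<times> nat \<Rightarrow> nat) \<Rightarrow> nat" where
  "coinv al F =
     card {(r, c, r') \<in> typeA al.
             \<not> is_inversion_triple (F (r, c - 1)) (F (r, c)) (F (r', c))}
   + card {(r, c, r') \<in> typeB al.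
             \<not> is_inversion_triple (F (r, c - 1)) (F (r, c)) (F (r', c - 1))}"

definition Emac :: "nat list \<Rightarrow> nat list \<Rightarrow> (nat \<Rightarrow> 'a::field) \<Rightarrow> 'a \<Rightarrow> 'a \<Rightarrow> 'a" where
  "Emac sigma al x q t =
     (\<Sum>F \<in> NAF sigma al.
        (\<Prod>u \<in> nb_boxes al. x (F u)) * q ^ maj al F * t ^ coinv al F *
        (\<Prod>u \<in> {u \<in> nb_boxes al. F u \<noteq> F (fst u, snd u - 1)}.
           (1 - t) / (1 - q ^ (1 + leg al u) * t ^ (1 + arm al u))))"

end

theory Submission
  imports Defs "HOL-Computational_Algebra.Polynomial" "HOL-Combinatorics.Transposition"
begin

text \<open>
  Place the box in row r and column c at position c * n + (n - r). Two boxes attack each other iff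
  their positions differ by less than n, and d(u) lies n positions before u. For a triple (a, b, e)
  of a non-attacking filling, the indicator of being a coinversion triple is
  [e < a] + [b < e] - [b \<le> a]; summing over all triples turns the coinversion statistic into a count
  of inverted attacking pairs, up to arm lengths and a constant depending only on the basement.
  Hence, up to powers of t, the polynomial is a partition function W of a one-dimensional system in
  which the entry at position p interacts only with the n preceding ones.

  Descending induction on p proves two facts about W, seen as a function of the preceding entries.
  Exchanging the labels i and i + 1 acts on the pair of values of W (before and after the exchange) by a
  Hecke relation: the pair has the form (A + B y, A + t B x) with x, y the variables
  with indices i and i + 1 and A, B symmetric in them. Exchanging two rows of equal length does not change W.
  When the basement entries of two adjacent equal rows are i and i + 1 both apply, so
  B y = t B x and B x = t B y, which forces the asymmetric part to vanish unless t^2 = 1. Finitely many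
  exceptional t are recovered because numerator and denominator are polynomials in t.
\<close>

section \<open>Two adjacent rows of equal length\<close>

text \<open>With y = q^(leg + 1) t^arm, this is the contribution of a box with entry b to the right of a.\<close>

definition wt :: "'a::field \<Rightarrow> 'a \<Rightarrow> nat \<Rightarrow> nat \<Rightarrow> 'a" where
  "wt t y a b = (if a = b then 1 else (if a < b then y else 1) * ((1 - t) / (1 - t * y)))"

text \<open>Joint weight of one column of two adjacent equal rows: a1, b1 are the consecutive entries of the
  upper row and a2, b2 those of the lower one, whose arm is smaller by one. The lower box precedes the
  upper one in position order.\<close>

definition row_pair_wt :: "'a::field \<Rightarrow> 'a \<Rightarrow> nat \<Rightarrow> nat \<Rightarrow> nat \<Rightarrow> nat \<Rightarrow> 'a" where
  "row_pair_wt t y a1 a2 b1 b2 = (if b2 = a1 \<or> b1 = b2 then 0 else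
     t ^ (of_bool (b2 < a1) + of_bool (b1 < b2)) * wt t y a2 b2 * wt t (t * y) a1 b1)"

text \<open>Summing over both orders of the new pair makes the old pair exchangeable; this is the
  local relation behind \<open>row_swap\<close>. Every relative order of the four entries reduces to
  two rational identities between the factors \<open>k\<close> of the lower box and
  \<open>k'\<close> of the upper one.\<close>

lemma row_pair_exchange:
  fixes t y :: "'a::field" and a1 a2 b1 b2 :: nat
  assumes nz: "1 - t * y \<noteq> 0" "1 - t * (t * y) \<noteq> 0"
  shows "row_pair_wt t y a1 a2 b1 b2 + row_pair_wt t y a1 a2 b2 b1
       = row_pair_wt t y a2 a1 b1 b2 + row_pair_wt t y a2 a1 b2 b1"
proof -
  define f where "f = row_pair_wt t y"
  define k where "k = (1 - t) / (1 - t * y)"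
  define k' where "k' = (1 - t) / (1 - t * (t * y))"
  have kk: "k' * (k + t) = k"
    using nz unfolding k_def k'_def by (simp add: divide_simps) algebra
  have kk2: "k' * (1 + t * y * k) = k"
    using nz unfolding k_def k'_def by (simp add: divide_simps) algebra
  have ww: "wt t y a b = (if a = b then 1 else (if a < b then y else 1) * k)"
      "wt t (t * y) a b = (if a = b then 1 else (if a < b then t * y else 1) * k')" for a b
    by (simp_all add: wt_def k_def k'_def)
  \<comment> \<open>Swapping \<open>a1\<close>, \<open>a2\<close> exchanges the two sides and
    swapping \<open>b1\<close>, \<open>b2\<close> permutes the summands, so increasing pairs
    suffice. Equal \<open>b1\<close>, \<open>b2\<close> give weight zero and equal
    \<open>a1\<close>, \<open>a2\<close> give identical sides.\<close>
  have wlog: "f a1 a2 b1 b2 + f a1 a2 b2 b1 = f a2 a1 b1 b2 + f a2 a1 b2 b1"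
    if "a1 < a2" "b1 < b2" for a1 a2 b1 b2
    using that
    apply (cases b1 a1 rule: linorder_cases; cases b1 a2 rule: linorder_cases;
          cases b2 a1 rule: linorder_cases; cases b2 a2 rule: linorder_cases;
         simp add: f_def row_pair_wt_def ww)
    using arg_cong[OF kk, of "\<lambda>z. t * z"] arg_cong[OF kk, of "\<lambda>z. t * (y * z)"]
      arg_cong[OF kk2, of "\<lambda>z. t * z"] arg_cong[OF kk2, of "\<lambda>z. t * (y * z)"]
    apply (simp_all add: algebra_simps)
    done
  have "f a a' b b = 0" for a a' b
    by (simp add: f_def row_pair_wt_def)
  then show ?thesis
    unfolding f_def[symmetric]
    by (cases a1 a2 rule: linorder_cases; cases b1 b2 rule: linorder_cases)
      (use wlog[of a1 a2 b1 b2] wlog[of a2 a1 b1 b2] wlog[of a1 a2 b2 b1] wlog[of a2 a1 b2 b1]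
        in \<open>simp_all add: add.commute\<close>)
qed

section \<open>Partition functions over positions\<close>

text \<open>P marks the positions of the diagram and g lists the entries before position p; W sums the weights
  of all ways of filling the m positions from p on. Positions outside the diagram carry 0, which is
  not an entry and hence never attacks or inverts.\<close>

locale scan =
  fixes n :: nat and P :: "nat \<Rightarrow> bool" and y :: "nat \<Rightarrow> 'a::field_char_0" and t :: 'a
begin

text \<open>The open window \<open>{p - n<..<p}\<close> holds the preceding positions that attack
  \<open>p\<close>, while \<open>p - n\<close> is the left neighbour of \<open>p\<close>.\<close>

definition step :: "(nat \<Rightarrow> 'a) \<Rightarrow> nat \<Rightarrow> (nat \<Rightarrow> nat) \<Rightarrow> nat \<Rightarrow> 'a" where
  "step x p g b = x b * t ^ card {s \<in> {p - n<..<p}. b < g s} * wt t (y p) (g (p - n)) b"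

primrec W :: "(nat \<Rightarrow> 'a) \<Rightarrow> nat \<Rightarrow> nat \<Rightarrow> (nat \<Rightarrow> nat) \<Rightarrow> 'a" where
  "W x 0 p g = 1"
| "W x (Suc m) p g =
     (if P p then \<Sum>b\<in>{1..n} - g ` {p - n<..<p}. step x p g b * W x m (Suc p) (g(p := b))
      else W x m (Suc p) (g(p := 0)))"

text \<open>Locality: a step reads at most \<open>n\<close> positions back, and positions from
  \<open>p\<close> on are overwritten before they are read. An entry may therefore be altered freely
  once it has left the window.\<close>

lemma W_window_cong:
  assumes "1 \<le> n" "n \<le> p" "\<And>s. s \<in> {p - n..<p} \<Longrightarrow> g s = h s"
  shows "W x m p g = W x m p h"
  using assms
proof (induction m arbitrary: p g h)
  case (Suc m)
  have IH: "W x m (Suc p) (g(p := b)) = W x m (Suc p) (h(p := b))" for b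
    by (rule Suc.IH) (use Suc.prems in auto)
  have "g ` {p - n<..<p} = h ` {p - n<..<p}"
    by (rule image_cong) (use Suc.prems(3) in auto)
  moreover have "step x p g b = step x p h b" for b
  proof -
    have "{s \<in> {p - n<..<p}. b < g s} = {s \<in> {p - n<..<p}. b < h s}"
      using Suc.prems(3) by auto
    moreover have "g (p - n) = h (p - n)"
      using Suc.prems by auto
    ultimately show ?thesis
      by (simp add: step_def)
  qed
  ultimately show ?case
    by (simp add: IH)
qed simp

end

section \<open>Exchanging two labels\<close>

text \<open>The arguments c, d are the values of a, b after exchanging the variables u and v; the coefficients A, B
  are shared because they are symmetric in u and v.\<close>

definition hecke_rel :: "'a::field \<Rightarrow> 'a \<Rightarrow> 'a \<Rightarrow> 'a \<Rightarrow> 'a \<Rightarrow> 'a \<Rightarrow> 'a \<Rightarrow> bool" where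
  "hecke_rel t u v a b c d \<longleftrightarrow> (\<exists>A B. a = A + B * v \<and> b = A + t * B * u \<and>
     c = A + B * u \<and> d = A + t * B * v)"

lemma hecke_rel_const: "hecke_rel t u v a a a a"
  unfolding hecke_rel_def by (rule exI[of _ a], rule exI[of _ 0]) simp

lemma hecke_rel_add:
  assumes "hecke_rel t u v a b c d" "hecke_rel t u v a' b' c' d'"
  shows "hecke_rel t u v (a + a') (b + b') (c + c') (d + d')"
proof -
  from assms obtain A B A' B' where
    "a = A + B * v" "b = A + t * B * u" "c = A + B * u" "d = A + t * B * v"
    "a' = A' + B' * v" "b' = A' + t * B' * u" "c' = A' + B' * u" "d' = A' + t * B' * v"
    unfolding hecke_rel_def by blast
  then show ?thesis
    unfolding hecke_rel_def by (intro exI[of _ "A + A'"] exI[of _ "B + B'"]) (simp add: algebra_simps)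
qed

text \<open>The factor \<open>k\<close> is common to all four values, which fits step weights
  unchanged by the exchange of labels and of variables.\<close>

lemma hecke_rel_scale:
  assumes "hecke_rel t u v a b c d"
  shows "hecke_rel t u v (k * a) (k * b) (k * c) (k * d)"
proof -
  from assms obtain A B where
    "a = A + B * v" "b = A + t * B * u" "c = A + B * u" "d = A + t * B * v"
    unfolding hecke_rel_def by blast
  then show ?thesis
    unfolding hecke_rel_def by (intro exI[of _ "k * A"] exI[of _ "k * B"]) (simp add: algebra_simps)
qed

lemma hecke_rel_sum:
  assumes "\<And>z. z \<in> S \<Longrightarrow> hecke_rel t u v (a z) (b z) (c z) (d z)"
  shows "hecke_rel t u v (sum a S) (sum b S) (sum c S) (sum d S)"
  using assms
  by (induction S rule: infinite_finite_induct) (auto intro: hecke_rel_const hecke_rel_add)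

context scan
begin

text \<open>No label lies strictly between i and i + 1, so comparisons with a third label
  \<open>b\<close> are not affected.\<close>

lemma step_transpose_label:
  assumes "b \<noteq> i" "b \<noteq> Suc i"
  shows "step x p (transpose i (Suc i) \<circ> g) b = step x p g b"
proof -
  have "b < transpose i (Suc i) v \<longleftrightarrow> b < v" and "transpose i (Suc i) v < b \<longleftrightarrow> v < b"
    and "transpose i (Suc i) v = b \<longleftrightarrow> v = b" for v
    using assms by (auto simp: transpose_def)
  then show ?thesis
    by (simp add: step_def wt_def)
qed

lemma step_transpose_variable:
  assumes "b \<noteq> i" "b \<noteq> Suc i"
  shows "step (x \<circ> transpose i (Suc i)) p g b = step x p g b"
  using assms by (simp add: step_def transpose_def)

lemma image_transpose_label:
  assumes "b \<noteq> i" "b \<noteq> Suc i"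
  shows "b \<in> (transpose i (Suc i) \<circ> g) ` Q \<longleftrightarrow> b \<in> g ` Q"
  using assms by (auto simp: image_iff transpose_def split: if_splits)

text \<open>The first part covers windows without i and i + 1, the second those whose last such entry, at s, is i.
  An earlier entry i + 1 in the window is irrelevant: any position it could still influence is attacked by s.\<close>

lemma label_swap:
  fixes x :: "nat \<Rightarrow> 'a" and i :: nat
  defines "\<tau> \<equiv> transpose i (Suc i)" and "I \<equiv> {i, Suc i}"
  assumes i: "1 \<le> i" "Suc i \<le> n" and nz: "\<And>p. P p \<Longrightarrow> 1 - t * y p \<noteq> 0"
    and np: "n \<le> p" and inj: "inj_on g {s \<in> {p - n..<p}. g s \<in> I}"
  shows "((\<forall>r\<in>{p - n..<p}. g r \<notin> I) \<longrightarrow> W x m p g = W (x \<circ> \<tau>) m p g) \<and>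
    (\<forall>s\<in>{p - n..<p}. g s = i \<longrightarrow> (\<forall>r\<in>{s<..<p}. g r \<notin> I) \<longrightarrow>
       hecke_rel t (x i) (x (Suc i)) (W x m p g) (W x m p (\<tau> \<circ> g))
         (W (x \<circ> \<tau>) m p g) (W (x \<circ> \<tau>) m p (\<tau> \<circ> g)))"
  using np inj
proof (induction m arbitrary: p g)
  case 0
  then show ?case by (simp add: hecke_rel_const)
next
  case (Suc m)
  define Q where "Q = {p - n<..<p}"
  have n1: "1 \<le> n" using i by simp
  have win: "{p - n..<p} = insert (p - n) Q" "{Suc p - n..<Suc p} = insert p Q"
    and nin: "p \<notin> Q" "p - n \<notin> Q" "p - n \<noteq> p"
    using n1 Suc.prems(1) by (auto simp: Q_def)
  have inj: "r = s" if "r \<in> insert (p - n) Q" "s \<in> insert (p - n) Q" "g r = g s" "g s \<in> I" for r s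
    using Suc.prems(2) that unfolding win inj_on_def by auto
  have tau_I: "\<tau> v \<in> I \<longleftrightarrow> v \<in> I" and tau_inj: "\<tau> v = \<tau> w \<longleftrightarrow> v = w" for v w
    by (auto simp: \<tau>_def I_def transpose_def split: if_splits)
  \<comment> \<open>Each of the two labels still occurs at most once in the shifted window: either
    the new entry is a third label, or it is absent from the surviving part
    \<open>Q\<close>.\<close>
  have inj': "inj_on (h(p := b)) {s \<in> {Suc p - n..<Suc p}. (h(p := b)) s \<in> I}"
    if "b \<notin> I \<or> b \<notin> h ` Q" "h = g \<or> h = \<tau> \<circ> g" for b h
  proof -
    have "r = s" if "r \<in> Q" "s \<in> Q" "h r = h s" "h s \<in> I" for r s
      using inj[of r s] that \<open>h = g \<or> h = \<tau> \<circ> g\<close> tau_I tau_inj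
      by auto
    then show ?thesis
      using that(1) nin unfolding win inj_on_def by (auto simp: image_iff)
  qed
  have IH0: "W x m (Suc p) (g(p := b)) = W (x \<circ> \<tau>) m (Suc p) (g(p := b))"
    if "b \<notin> I" "\<forall>r\<in>Q. g r \<notin> I" for b
  proof -
    have "\<forall>r\<in>{Suc p - n..<Suc p}. (g(p := b)) r \<notin> I"
      using that nin unfolding win by auto
    with conjunct1[OF Suc.IH[OF le_SucI[OF Suc.prems(1)] inj'[OF disjI1[OF that(1)] disjI1[OF refl]]]]
    show ?thesis by (rule mp)
  qed
  have IH1: "hecke_rel t (x i) (x (Suc i)) (W x m (Suc p) h) (W x m (Suc p) (\<tau> \<circ> h))
         (W (x \<circ> \<tau>) m (Suc p) h) (W (x \<circ> \<tau>) m (Suc p) (\<tau> \<circ> h))"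
    if "inj_on h {s \<in> {Suc p - n..<Suc p}. h s \<in> I}"
      "s \<in> insert p Q" "h s = i" "\<forall>r\<in>{s<..<Suc p}. h r \<notin> I" for h s
    by (rule conjunct2[OF Suc.IH[OF le_SucI[OF Suc.prems(1)] that(1)], THEN bspec, THEN mp, THEN mp])
      (use that in \<open>simp_all only: win\<close>)
  have upd: "(\<tau> \<circ> g)(p := b) = \<tau> \<circ> (g(p := b))" if "b \<notin> I" for b
    using that by (auto simp: \<tau>_def I_def transpose_def fun_eq_iff)
  \<comment> \<open>Inside the current window the exchange can then only alter position
    \<open>p - n\<close>, which the next window no longer contains.\<close>
  have drop: "W z m (Suc p) ((\<tau> \<circ> g)(p := b)) = W z m (Suc p) (g(p := b))"
    if "\<forall>r\<in>Q. g r \<notin> I" for z b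
  proof (rule W_window_cong[OF n1])
    fix r assume "r \<in> {Suc p - n..<Suc p}"
    then show "((\<tau> \<circ> g)(p := b)) r = (g(p := b)) r"
      using that unfolding win by (auto simp: \<tau>_def I_def transpose_def)
  qed (use Suc.prems(1) in simp)
  \<comment> \<open>The new entry is a third label: if \<open>s\<close> leaves the window, no
    exchanged label remains and the four values coincide; otherwise \<open>s\<close> still carries
    the last one.\<close>
  have ground: "hecke_rel t (x i) (x (Suc i)) (W x m (Suc p) (g(p := b)))
        (W x m (Suc p) ((\<tau> \<circ> g)(p := b)))
        (W (x \<circ> \<tau>) m (Suc p) (g(p := b))) (W (x \<circ> \<tau>) m (Suc p) ((\<tau> \<circ> g)(p := b)))"
    if s: "s \<in> insert (p - n) Q" "g s = i" "\<forall>r\<in>{s<..<p}. g r \<notin> I" and b: "b \<notin> I" for s b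
  proof (cases "s = p - n")
    case True
    then have "\<forall>r\<in>Q. g r \<notin> I"
      using s by (simp add: Q_def)
    then show ?thesis
      using IH0[OF b] by (simp add: drop hecke_rel_const)
  next
    case False
    then have "s \<in> Q" using s by simp
    moreover have "\<forall>r\<in>{s<..<Suc p}. (g(p := b)) r \<notin> I"
      using s(3) b by (auto simp: less_Suc_eq)
    ultimately show ?thesis
      unfolding upd[OF b] using s nin by (intro IH1[of _ s] inj') (use b in auto)
  qed
  show ?case
  proof (cases "P p")
    case False
    have "0 \<notin> I" using i by (simp add: I_def)
    have skip: "W z (Suc m) p h = W z m (Suc p) (h(p := 0))" for z h
      using False by simp
    show ?thesis
      unfolding skip win
    proof (intro conjI impI ballI)
      assume "\<forall>r\<in>insert (p - n) Q. g r \<notin> I"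
      then show "W x m (Suc p) (g(p := 0)) = W (x \<circ> \<tau>) m (Suc p) (g(p := 0))"
        by (intro IH0 \<open>0 \<notin> I\<close>) simp
    qed (rule ground[OF _ _ _ \<open>0 \<notin> I\<close>])
  next
    case True
    \<comment> \<open>\<open>T\<close> is the term of the new entry \<open>b\<close>; the sum splits
      into the third labels \<open>G\<close> and the labels i and i + 1 themselves.\<close>
    define T where "T = (\<lambda>z h b. step z p h b * W z m (Suc p) (h(p := b)))"
    define G where "G = {1..n} - g ` Q - I"
    have G': "{1..n} - (\<tau> \<circ> g) ` Q - I = G"
      unfolding G_def \<tau>_def using image_transpose_label[of _ i g Q] by (auto simp: I_def)
    have W_split: "W z (Suc m) p h = sum (T z h) G + sum (T z h) (({1..n} - h ` Q) \<inter> I)"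
      if "h = g \<or> h = \<tau> \<circ> g" for z h
    proof -
      have "{1..n} - h ` Q - I = G"
        using that by (elim disjE) (simp_all only: G' G_def)
      then show ?thesis
        using True sum.Int_Diff[of "{1..n} - h ` Q" "T z h" I] by (simp add: T_def Q_def add.commute)
    qed
    have I_sub: "I \<subseteq> {1..n}" using i by (auto simp: I_def)
    show ?thesis
    proof (intro conjI impI ballI)
      assume none: "\<forall>r\<in>{p - n..<p}. g r \<notin> I"
      have "({1..n} - g ` Q) \<inter> I = I"
        using none I_sub unfolding win by auto
      moreover have "sum (T x g) G = sum (T (x \<circ> \<tau>) g) G"
        using none unfolding win
        by (intro sum.cong) (auto simp: T_def G_def I_def \<tau>_def[symmetric] IH0 step_transpose_variable[of _ i, folded \<tau>_def])
      \<comment> \<open>Both labels can be placed with the same factor \<open>c\<close>, and the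
        Hecke relation of the two continuations turns the sum into
        \<open>c * (A * (x_i + x_(i+1)) + (1 + t) * B * x_i * x_(i+1))\<close>, which is
        symmetric.\<close>
      moreover have "sum (T x g) I = sum (T (x \<circ> \<tau>) g) I"
      proof -
        define c where "c = t ^ card {s \<in> Q. i < g s} * wt t (y p) (g (p - n)) i"
        have c: "step z p g i = z i * c" "step z p g (Suc i) = z (Suc i) * c" for z
        proof -
          show "step z p g i = z i * c"
            by (simp add: step_def c_def Q_def)
          have "{s \<in> Q. Suc i < g s} = {s \<in> Q. i < g s}"
            using none unfolding win by (auto simp: I_def)
          moreover have "wt t (y p) (g (p - n)) (Suc i) = wt t (y p) (g (p - n)) i"
            using none unfolding win by (auto simp: I_def wt_def)
          ultimately show "step z p g (Suc i) = z (Suc i) * c"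
            by (simp add: step_def c_def Q_def)
        qed
        have "hecke_rel t (x i) (x (Suc i)) (W x m (Suc p) (g(p := i)))
               (W x m (Suc p) (\<tau> \<circ> g(p := i)))
               (W (x \<circ> \<tau>) m (Suc p) (g(p := i))) (W (x \<circ> \<tau>) m (Suc p) (\<tau> \<circ> g(p := i)))"
          by (rule IH1[of _ p], rule inj') (use none in \<open>auto simp: win I_def\<close>)
        moreover have "W z m (Suc p) (\<tau> \<circ> g(p := i)) = W z m (Suc p) (g(p := Suc i))" for z
        proof -
          have "\<tau> \<circ> g(p := i) = (\<tau> \<circ> g)(p := Suc i)"
            by (auto simp: \<tau>_def)
          then show ?thesis
            using none unfolding win by (simp add: drop)
        qed
        ultimately obtain A B where AB:
          "W x m (Suc p) (g(p := i)) = A + B * x (Suc i)"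
          "W x m (Suc p) (g(p := Suc i)) = A + t * B * x i"
          "W (x \<circ> \<tau>) m (Suc p) (g(p := i)) = A + B * x i"
          "W (x \<circ> \<tau>) m (Suc p) (g(p := Suc i)) = A + t * B * x (Suc i)"
          unfolding hecke_rel_def by auto
        show ?thesis
          by (simp add: I_def T_def c AB) (simp add: \<tau>_def algebra_simps)
      qed
      ultimately show "W x (Suc m) p g = W (x \<circ> \<tau>) (Suc m) p g"
        by (simp only: W_split[OF disjI1[OF refl]])
    next
      fix s assume s: "s \<in> {p - n..<p}" "g s = i" "\<forall>r\<in>{s<..<p}. g r \<notin> I"
      note s' = s[unfolded win]
      have "hecke_rel t (x i) (x (Suc i)) (T x g b) (T x (\<tau> \<circ> g) b)
              (T (x \<circ> \<tau>) g b) (T (x \<circ> \<tau>) (\<tau> \<circ> g) b)" if "b \<in> G" for b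
      proof -
        have b: "b \<notin> I" "b \<noteq> i" "b \<noteq> Suc i"
          using that by (auto simp: G_def I_def)
        show ?thesis
          unfolding T_def
          by (simp only: step_transpose_variable[OF b(2,3), folded \<tau>_def]
              step_transpose_label[OF b(2,3), folded \<tau>_def])
            (rule hecke_rel_scale[OF ground[OF s' b(1)]])
      qed
      note ground_part = hecke_rel_sum[OF this]
      have label_part: "hecke_rel t (x i) (x (Suc i))
         (sum (T x g) (({1..n} - g ` Q) \<inter> I)) (sum (T x (\<tau> \<circ> g)) (({1..n} - (\<tau> \<circ> g) ` Q) \<inter> I))
         (sum (T (x \<circ> \<tau>) g) (({1..n} - g ` Q) \<inter> I))
         (sum (T (x \<circ> \<tau>) (\<tau> \<circ> g)) (({1..n} - (\<tau> \<circ> g) ` Q) \<inter> I))"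
      \<comment> \<open>If the last label sits at \<open>p - n\<close>, either label may be placed
        next, and its comparison with this left neighbour gives the factors 1, \<open>k\<close> and
        \<open>y p * k\<close>.\<close>
      proof (cases "s = p - n")
        case True
        then have none: "\<forall>r\<in>Q. g r \<notin> I"
          using s by (simp add: Q_def)
        have sets: "({1..n} - g ` Q) \<inter> I = {i, Suc i}" "({1..n} - (\<tau> \<circ> g) ` Q) \<inter> I = {i, Suc i}"
          using none I_sub by (auto simp: I_def \<tau>_def transpose_def split: if_splits)
        define c where "c = t ^ card {r \<in> Q. i < g r}"
        define k where "k = (1 - t) / (1 - t * y p)"
        have cards: "{r \<in> Q. Suc i < g r} = {r \<in> Q. i < g r}"
          "{r \<in> Q. i < (\<tau> \<circ> g) r} = {r \<in> Q. i < g r}" "{r \<in> Q. Suc i < (\<tau> \<circ> g) r} = {r \<in> Q. i < g r}"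
          using none by (auto simp: I_def \<tau>_def transpose_def split: if_splits intro: Suc_lessI)
        have steps: "step z p g i = z i * c" "step z p g (Suc i) = z (Suc i) * c * (y p * k)"
          "step z p (\<tau> \<circ> g) i = z i * c * k" "step z p (\<tau> \<circ> g) (Suc i) = z (Suc i) * c" for z
          using s(2) True unfolding step_def Q_def[symmetric] cards
          by (simp_all add: c_def k_def wt_def \<tau>_def)
        \<comment> \<open>This equates the coefficients of \<open>B * x i * x (Suc i)\<close> in the
          two sums. The witnesses below are read off by comparing coefficients.\<close>
        have k: "1 + t * (y p * k) = k + t"
          using nz[OF \<open>P p\<close>] by (simp add: k_def divide_simps) algebra
        have "hecke_rel t (x i) (x (Suc i)) (W x m (Suc p) (g(p := i)))
               (W x m (Suc p) (\<tau> \<circ> g(p := i)))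
               (W (x \<circ> \<tau>) m (Suc p) (g(p := i))) (W (x \<circ> \<tau>) m (Suc p) (\<tau> \<circ> g(p := i)))"
          by (rule IH1[of _ p], rule inj') (use none in \<open>auto simp: win I_def\<close>)
        moreover have "W z m (Suc p) (\<tau> \<circ> g(p := i)) = W z m (Suc p) (g(p := Suc i))" for z
        proof -
          have "\<tau> \<circ> g(p := i) = (\<tau> \<circ> g)(p := Suc i)"
            by (auto simp: \<tau>_def)
          then show ?thesis
            using none by (simp add: drop)
        qed
        ultimately obtain A B where AB:
          "W x m (Suc p) (g(p := i)) = A + B * x (Suc i)"
          "W x m (Suc p) (g(p := Suc i)) = A + t * B * x i"
          "W (x \<circ> \<tau>) m (Suc p) (g(p := i)) = A + B * x i"
          "W (x \<circ> \<tau>) m (Suc p) (g(p := Suc i)) = A + t * B * x (Suc i)"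
          unfolding hecke_rel_def by auto
        have tk: "t * (y p * k) = k + t - 1" using k by (simp add: algebra_simps)
        show ?thesis
          unfolding sets hecke_rel_def
          apply (rule exI[of _ "c * (B * x i * x (Suc i) * (1 + t * (y p * k)) + A * (x i + x (Suc i)))"])
          apply (rule exI[of _ "c * A * (y p * k - 1)"])
          apply (simp add: T_def steps drop[OF none] AB)
          using arg_cong[OF tk, of "\<lambda>z. c * A * x i * z"]
            arg_cong[OF tk, of "\<lambda>z. c * A * x (Suc i) * z"]
            arg_cong[OF tk, of "\<lambda>z. c * B * x i * x (Suc i) * z"]
          apply (simp add: \<tau>_def algebra_simps)
          done
      next
        case False
        then have sQ: "s \<in> Q" using s' by simp
        show ?thesis
        proof (cases "Suc i \<in> g ` Q")
          \<comment> \<open>Both labels already attack position \<open>p\<close>, so neither can be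
            placed and all four sums are empty.\<close>
          case True
          have "({1..n} - g ` Q) \<inter> I = {}"
            using True sQ s(2) by (auto simp: I_def)
          moreover have "({1..n} - (\<tau> \<circ> g) ` Q) \<inter> I = {}"
          proof -
            obtain r where "r \<in> Q" "g r = Suc i" using True by auto
            then have "i \<in> (\<tau> \<circ> g) ` Q" by (intro image_eqI[of _ _ r]) (auto simp: \<tau>_def)
            moreover have "Suc i \<in> (\<tau> \<circ> g) ` Q"
              using sQ s(2) by (intro image_eqI[of _ _ s]) (auto simp: \<tau>_def)
            ultimately show ?thesis by (auto simp: I_def)
          qed
          ultimately show ?thesis by (simp add: hecke_rel_const)
        next
          \<comment> \<open>Only the absent label can be placed: i + 1 after \<open>g\<close>, and i
            after the exchanged window.\<close>
          case False': False
          have Suc_in: "Suc i \<in> (\<tau> \<circ> g) ` Q"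
            using sQ s(2) by (intro image_eqI[of _ _ s]) (auto simp: \<tau>_def)
          have i_nin: "i \<notin> (\<tau> \<circ> g) ` Q"
            using False' by (auto simp: \<tau>_def transpose_def image_iff split: if_splits)
          have sets: "({1..n} - g ` Q) \<inter> I = {Suc i}" "({1..n} - (\<tau> \<circ> g) ` Q) \<inter> I = {i}"
            using Suc_in i_nin False' sQ s(2) I_sub by (auto simp: I_def)
          define c where "c = t ^ card {r \<in> Q. Suc i < g r} * wt t (y p) (g (p - n)) (Suc i)"
          have step1: "step z p g (Suc i) = z (Suc i) * c" for z
            by (simp add: step_def c_def Q_def)
          \<comment> \<open>Placing i after the i + 1 at \<open>s\<close> creates one inversion more
            than placing i + 1 after i; this is the extra \<open>t\<close>.\<close>
          have step2: "step z p (\<tau> \<circ> g) i = z i * t * c" for z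
          proof -
            have "r = s" if "r \<in> Q" "g r = i" for r
              using inj[of r s] sQ s(2) that by (auto simp: I_def)
            moreover have "i < \<tau> v \<longleftrightarrow> v = i \<or> Suc i < v" for v
              by (auto simp: \<tau>_def transpose_def)
            ultimately have "{r \<in> Q. i < (\<tau> \<circ> g) r} = insert s {r \<in> Q. Suc i < g r}"
              using sQ s(2) unfolding comp_apply by blast
            moreover have "finite Q" by (simp add: Q_def)
            ultimately have "card {r \<in> Q. i < (\<tau> \<circ> g) r} = Suc (card {r \<in> Q. Suc i < g r})"
              using s(2) by simp
            moreover have "g (p - n) \<noteq> i"
              using inj[of "p - n" s] False s' by (auto simp: I_def)
            then have "wt t (y p) ((\<tau> \<circ> g) (p - n)) i = wt t (y p) (g (p - n)) (Suc i)"
              by (auto simp: wt_def \<tau>_def transpose_def)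
            ultimately show ?thesis
              unfolding step_def Q_def[symmetric] by (simp add: c_def)
          qed
          have "\<tau> \<circ> (\<tau> \<circ> g)(p := i) = g(p := Suc i)"
            by (auto simp: \<tau>_def fun_eq_iff)
          moreover have "hecke_rel t (x i) (x (Suc i)) (W x m (Suc p) ((\<tau> \<circ> g)(p := i)))
               (W x m (Suc p) (\<tau> \<circ> (\<tau> \<circ> g)(p := i)))
               (W (x \<circ> \<tau>) m (Suc p) ((\<tau> \<circ> g)(p := i)))
               (W (x \<circ> \<tau>) m (Suc p) (\<tau> \<circ> (\<tau> \<circ> g)(p := i)))"
            by (rule IH1[of _ p], rule inj') (use i_nin in auto)
          ultimately obtain A B where AB:
            "W x m (Suc p) ((\<tau> \<circ> g)(p := i)) = A + B * x (Suc i)"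
            "W x m (Suc p) (g(p := Suc i)) = A + t * B * x i"
            "W (x \<circ> \<tau>) m (Suc p) ((\<tau> \<circ> g)(p := i)) = A + B * x i"
            "W (x \<circ> \<tau>) m (Suc p) (g(p := Suc i)) = A + t * B * x (Suc i)"
            unfolding hecke_rel_def by auto
          show ?thesis
            unfolding sets hecke_rel_def
            \<comment> \<open>The roles interchange: the old \<open>B\<close> enters the new
              \<open>A\<close>, and the old \<open>A\<close> the new \<open>B\<close>.\<close>
            apply (rule exI[of _ "t * B * x i * x (Suc i) * c"])
            apply (rule exI[of _ "A * c"])
            apply (simp add: T_def step1 step2 AB)
            apply (simp add: \<tau>_def algebra_simps)
            done
        qed
      qed
      show "hecke_rel t (x i) (x (Suc i)) (W x (Suc m) p g) (W x (Suc m) p (\<tau> \<circ> g))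
         (W (x \<circ> \<tau>) (Suc m) p g) (W (x \<circ> \<tau>) (Suc m) p (\<tau> \<circ> g))"
        unfolding W_split[OF disjI1[OF refl]] W_split[OF disjI2[OF refl]]
        by (rule hecke_rel_add[OF ground_part label_part])
    qed
  qed
qed


section \<open>Exchanging two rows\<close>

text \<open>Exclusions involving the upper box of the previous column or the other new entry are
  moved into the zeros of \<open>row_pair_wt\<close>. Both new entries then range over the same set,
  which opens the sum to symmetrisation in \<open>b1\<close>, \<open>b2\<close>.\<close>

lemma step_pair_sum:
  fixes h :: "nat \<Rightarrow> nat"
  assumes n2: "2 \<le> n" and P: "P (p + n)" "P (Suc (p + n))" and y: "y (Suc (p + n)) = t * y (p + n)"
  defines "R \<equiv> {Suc p<..<p + n}"
  defines "cnt \<equiv> \<lambda>b. card {s \<in> R. b < h s}"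
  shows "W x (Suc (Suc k)) (p + n) h =
    (\<Sum>b1\<in>{1..n} - h ` R. \<Sum>b2\<in>{1..n} - h ` R.
       x b1 * x b2 * t ^ (cnt b1 + cnt b2) * W x k (Suc (Suc (p + n))) (h(p + n := b2, Suc (p + n) := b1))
       * row_pair_wt t (y (p + n)) (h (Suc p)) (h p) b1 b2)"
proof -
  define r where "r = p + n"
  define L where "L = {1..n} - h ` R"
  have Q: "{r - n<..<r} = insert (Suc p) R" "{Suc r - n<..<Suc r} = insert r R"
    and nin: "Suc p \<notin> R" "r \<notin> R" "Suc r \<notin> R" and fin: "finite R"
    using n2 by (auto simp: r_def R_def)
  have sub: "r - n = p" "Suc r - n = Suc p" using n2 by (auto simp: r_def)
  have step1: "step x r h b2 = x b2 * t ^ (cnt b2 + of_bool (b2 < h (Suc p))) * wt t (y r) (h p) b2" for b2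
  proof -
    have "{s \<in> insert (Suc p) R. b2 < h s} =
        (if b2 < h (Suc p) then insert (Suc p) {s \<in> R. b2 < h s} else {s \<in> R. b2 < h s})"
      by auto
    then show ?thesis
      unfolding step_def Q unfolding sub using nin fin by (simp add: cnt_def)
  qed
  have step2: "step x (Suc r) (h(r := b2)) b1 =
      x b1 * t ^ (cnt b1 + of_bool (b1 < b2)) * wt t (t * y r) (h (Suc p)) b1" for b1 b2
  proof -
    have "{s \<in> insert r R. b1 < (h(r := b2)) s} =
        (if b1 < b2 then insert r {s \<in> R. b1 < h s} else {s \<in> R. b1 < h s})"
      using nin by auto
    moreover have "Suc p \<noteq> r" using n2 by (simp add: r_def)
    ultimately show ?thesis
      unfolding step_def Q unfolding sub using nin fin y by (simp add: cnt_def r_def)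
  qed
  have img: "(h(r := b)) ` insert r R = insert b (h ` R)" for b
    using nin by auto
  define \<phi> where "\<phi> = (\<lambda>b1 b2. x b1 * x b2 * t ^ (cnt b1 + cnt b2) *
      W x k (Suc (Suc r)) (h(r := b2, Suc r := b1)))"
  define f where "f = row_pair_wt t (y r) (h (Suc p)) (h p)"
  have inner: "step x r h b2 * W x (Suc k) (Suc r) (h(r := b2)) = (\<Sum>b1\<in>L. \<phi> b1 b2 * f b1 b2)"
    if "b2 \<noteq> h (Suc p)" for b2
  proof -
    have "W x (Suc k) (Suc r) (h(r := b2)) =
       (\<Sum>b1\<in>L - {b2}. step x (Suc r) (h(r := b2)) b1 * W x k (Suc (Suc r)) (h(r := b2, Suc r := b1)))"
    proof -
      have "{1..n} - (h(r := b2)) ` {Suc r - n<..<Suc r} = L - {b2}"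
        unfolding Q img L_def by auto
      then show ?thesis
        using P(2) by (simp only: W.simps r_def if_True)
    qed
    then have "step x r h b2 * W x (Suc k) (Suc r) (h(r := b2)) =
       (\<Sum>b1\<in>L - {b2}. step x r h b2 * (step x (Suc r) (h(r := b2)) b1 *
         W x k (Suc (Suc r)) (h(r := b2, Suc r := b1))))"
      by (simp add: sum_distrib_left)
    also have "\<dots> = (\<Sum>b1\<in>L - {b2}. \<phi> b1 b2 * f b1 b2)"
      using that
      by (intro sum.cong) (auto simp: step1 step2 \<phi>_def f_def row_pair_wt_def power_add algebra_simps)
    also have "\<dots> = (\<Sum>b1\<in>L. \<phi> b1 b2 * f b1 b2)"
      by (rule sum.mono_neutral_left) (auto simp: L_def f_def row_pair_wt_def)
    finally show ?thesis .
  qed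
  have "W x (Suc (Suc k)) r h = (\<Sum>b2\<in>L - {h (Suc p)}. step x r h b2 * W x (Suc k) (Suc r) (h(r := b2)))"
  proof -
    have "{1..n} - h ` {r - n<..<r} = L - {h (Suc p)}"
      unfolding Q L_def by auto
    then show ?thesis
      using P(1) by (simp only: W.simps(2)[of x "Suc k"] r_def if_True)
  qed
  also have "\<dots> = (\<Sum>b2\<in>L - {h (Suc p)}. \<Sum>b1\<in>L. \<phi> b1 b2 * f b1 b2)"
    by (intro sum.cong) (simp_all add: inner del: W.simps)
  also have "\<dots> = (\<Sum>b2\<in>L. \<Sum>b1\<in>L. \<phi> b1 b2 * f b1 b2)"
    by (rule sum.mono_neutral_left) (auto simp: L_def f_def row_pair_wt_def)
  also have "\<dots> = (\<Sum>b1\<in>L. \<Sum>b2\<in>L. \<phi> b1 b2 * f b1 b2)"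
    by (rule sum.swap)
  finally show ?thesis
    by (simp add: \<phi>_def f_def L_def r_def del: W.simps)
qed

text \<open>Strong induction on the number of remaining positions. Nothing happens until the scan
  reaches the next column of the pair; there the induction hypothesis for that column makes the
  continuation symmetric, and \<open>row_pair_exchange\<close> transfers the symmetry to the
  previous column.\<close>

lemma row_swap:
  assumes p0: "Suc p0 < n"
    and P: "\<And>c. P (Suc (p0 + c * n)) \<longleftrightarrow> P (p0 + c * n)"
    and y: "\<And>c. 1 \<le> c \<Longrightarrow> P (p0 + c * n) \<Longrightarrow> y (Suc (p0 + c * n)) = t * y (p0 + c * n)"
    and nz: "\<And>p. P p \<Longrightarrow> 1 - t * y p \<noteq> 0"
  shows "p = p0 + c * n \<Longrightarrow> p + 2 \<le> r \<Longrightarrow> r \<le> p + n \<Longrightarrow> n \<le> r \<Longrightarrow> r + m = C * n \<Longrightarrow>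
    W x m r g = W x m r (g \<circ> transpose p (Suc p))"
proof (induction m arbitrary: p c r g rule: less_induct)
  case (less m)
  define \<sigma> where "\<sigma> = transpose p (Suc p)"
  have n1: "1 \<le> n" "2 \<le> n" using p0 by auto
  show ?case
  proof (cases m)
    case 0
    then show ?thesis by simp
  next
    case (Suc k)
    show ?thesis
    proof (cases "r < p + n")
      \<comment> \<open>Both exchanged positions still lie in the open window, where a step sees
        only the set of entries and the number of larger ones.\<close>
      case True
      define Q where "Q = {r - n<..<r}"
      have IH: "W x k (Suc r) h = W x k (Suc r) (h \<circ> \<sigma>)" for h
        unfolding \<sigma>_def using less.prems Suc True by (intro less.IH[of k p c]) auto
      have "p \<in> Q" "Suc p \<in> Q"
        using less.prems True by (auto simp: Q_def)
      then have \<sigma>Q: "\<sigma> ` Q = Q"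
        by (simp add: \<sigma>_def transpose_image_eq)
      have upd: "(g \<circ> \<sigma>)(r := b) = g(r := b) \<circ> \<sigma>" for b
        using less.prems by (auto simp: \<sigma>_def transpose_def fun_eq_iff)
      have "{s \<in> Q. b < g s} = \<sigma> ` {s \<in> Q. b < (g \<circ> \<sigma>) s}" for b
      proof -
        have "\<sigma> ` {s \<in> Q. b < g (\<sigma> s)} = {s \<in> \<sigma> ` Q. b < g s}"
          by auto
        then show ?thesis by (simp add: \<sigma>Q)
      qed
      then have "card {s \<in> Q. b < g s} = card {s \<in> Q. b < (g \<circ> \<sigma>) s}" for b
        by (simp add: card_image \<sigma>_def)
      moreover have "\<sigma> (r - n) = r - n"
        using less.prems True n1 unfolding \<sigma>_def by (intro transpose_apply_other) auto
      ultimately have steps: "step x r (g \<circ> \<sigma>) b = step x r g b" for b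
        by (simp add: step_def Q_def)
      have img: "(g \<circ> \<sigma>) ` Q = g ` Q"
        by (metis \<sigma>Q image_comp)
      show ?thesis
        unfolding Suc W.simps Q_def[symmetric] \<sigma>_def[symmetric] img steps upd
        using IH by simp
    next
      case False
      then have r: "r = p + n" "r = p0 + Suc c * n" using less.prems by auto
      \<comment> \<open>A scan ending at a multiple of \<open>n\<close> cannot stop between the two
        rows of the pair.\<close>
      have "m \<noteq> 1"
      proof
        assume "m = 1"
        then have "Suc p0 + Suc c * n = C * n" using less.prems r by simp
        then have "(Suc p0 + Suc c * n) mod n = 0" by simp
        then show False using p0 by (simp only: mod_mult_self1) simp
      qed
      then obtain k' where m: "m = Suc (Suc k')"
        using Suc by (cases k) auto
      have PP: "P (Suc r) \<longleftrightarrow> P r" using P[of "Suc c"] r by simp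
      have drop: "W x k' (Suc (Suc r)) (g(r := a, Suc r := b)) =
          W x k' (Suc (Suc r)) ((g \<circ> \<sigma>)(r := a, Suc r := b))" for a b
        by (rule W_window_cong) (use n1 r in \<open>auto simp: \<sigma>_def transpose_def\<close>)
      show ?thesis
      proof (cases "P r")
        case False
        then show ?thesis
          unfolding \<sigma>_def[symmetric] m W.simps using PP by (simp only: if_False drop)
      next
        case True
        define R where "R = {Suc p<..<p + n}"
        define L where "L = {1..n} - g ` R"
        define cnt where "cnt = (\<lambda>b. card {s \<in> R. b < g s})"
        define \<phi> where "\<phi> = (\<lambda>b1 b2. x b1 * x b2 * t ^ (cnt b1 + cnt b2) *
           W x k' (Suc (Suc r)) (g(r := b2, Suc r := b1)))"
        define f where "f = row_pair_wt t (y r)"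
        define S where "S = (\<lambda>a1 a2. \<Sum>b1\<in>L. \<Sum>b2\<in>L. \<phi> b1 b2 * f a1 a2 b1 b2)"
        have yr: "y (Suc r) = t * y r"
          using y[of "Suc c"] True unfolding r(2) by simp
        have same: "(g \<circ> \<sigma>) s = g s" if "s \<in> R" for s
          using that by (auto simp: \<sigma>_def R_def transpose_def)
        have S1: "W x m r g = S (g (Suc p)) (g p)"
          unfolding m using step_pair_sum[where p = p and h = g and x = x and k = k'] n1 True PP yr
          by (simp add: r(1) R_def L_def cnt_def \<phi>_def f_def S_def del: W.simps)
        have "{s \<in> R. b < (g \<circ> \<sigma>) s} = {s \<in> R. b < g s}" for b
          using same by auto
        moreover have "(g \<circ> \<sigma>) ` R = g ` R"
          using same by (rule image_cong[OF refl])
        ultimately have S2: "W x m r (g \<circ> \<sigma>) = S (g p) (g (Suc p))"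
          unfolding m using step_pair_sum[where p = p and h = "g \<circ> \<sigma>" and x = x and k = k'] n1 True PP yr drop
          by (simp add: r(1) R_def L_def cnt_def \<phi>_def f_def S_def \<sigma>_def del: W.simps)
        have sym: "\<phi> b1 b2 = \<phi> b2 b1" for b1 b2
        proof -
          have "g(r := b2, Suc r := b1) \<circ> transpose r (Suc r) = g(r := b1, Suc r := b2)"
            by (auto simp: fun_eq_iff transpose_def)
          moreover have "W x k' (Suc (Suc r)) (g(r := b2, Suc r := b1)) =
             W x k' (Suc (Suc r)) (g(r := b2, Suc r := b1) \<circ> transpose r (Suc r))"
            by (rule less.IH[of _ _ "Suc c"]) (use less.prems r n1 m in auto)
          ultimately have "W x k' (Suc (Suc r)) (g(r := b2, Suc r := b1)) =
             W x k' (Suc (Suc r)) (g(r := b1, Suc r := b2))"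
            by (simp only:)
          then show ?thesis
            by (simp only: \<phi>_def mult.commute[of "x b1" "x b2"] add.commute[of "cnt b1" "cnt b2"])
        qed
        \<comment> \<open>Adding the two orders of the new entries produces the sums treated by
          \<open>row_pair_exchange\<close>; characteristic zero later removes the factor 2.\<close>
        have dbl: "2 * S a1 a2 = (\<Sum>b1\<in>L. \<Sum>b2\<in>L. \<phi> b1 b2 * (f a1 a2 b1 b2 + f a1 a2 b2 b1))" for a1 a2
        proof -
          have "S a1 a2 = (\<Sum>b1\<in>L. \<Sum>b2\<in>L. \<phi> b1 b2 * f a1 a2 b2 b1)"
            unfolding S_def by (subst sum.swap) (simp add: sym)
          then have "2 * S a1 a2 = S a1 a2 + (\<Sum>b1\<in>L. \<Sum>b2\<in>L. \<phi> b1 b2 * f a1 a2 b2 b1)"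
            by simp
          then show ?thesis
            by (simp add: S_def sum.distrib distrib_left)
        qed
        have "1 - t * y r \<noteq> 0" "1 - t * (t * y r) \<noteq> 0"
          using nz[of r] nz[of "Suc r"] True PP yr by auto
        then have "2 * S (g (Suc p)) (g p) = 2 * S (g p) (g (Suc p))"
          unfolding dbl f_def by (subst row_pair_exchange) auto
        then show ?thesis
          unfolding \<sigma>_def[symmetric] S1 S2 by simp
      qed
    qed
  qed
qed

end

section \<open>Boxes and positions\<close>

definition cell :: "nat \<Rightarrow> nat \<Rightarrow> nat \<times> nat" where
  "cell n p = (n - p mod n, p div n)"

definition pos :: "nat \<Rightarrow> nat \<times> nat \<Rightarrow> nat" where
  "pos n u = snd u * n + (n - fst u)"

lemma cell_pos: "1 \<le> r \<Longrightarrow> r \<le> n \<Longrightarrow> cell n (pos n (r, c)) = (r, c)"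
proof -
  assume "1 \<le> r" "r \<le> n"
  then obtain k where "n - r = k" "k < n" "n - k = r" by auto
  then show ?thesis by (simp add: cell_def pos_def)
qed

lemma pos_cell: "1 \<le> n \<Longrightarrow> pos n (cell n p) = p"
  by (simp add: cell_def pos_def)

lemma cell_row: "1 \<le> n \<Longrightarrow> 1 \<le> fst (cell n p) \<and> fst (cell n p) \<le> n"
  by (simp add: cell_def Suc_le_eq)

lemma cell_left: "n \<le> p \<Longrightarrow> cell n (p - n) = (fst (cell n p), snd (cell n p) - 1)"
  by (cases "n = 0") (simp_all add: cell_def le_mod_geq le_div_geq)

text \<open>Writing \<open>s = c' * n + (n - r')\<close>, the bounds leave only two columns and then
  decide on which side of row \<open>r\<close> the box lies: the attacking shape of
  \<open>non_attacking\<close>.\<close>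

lemma pos_window_cases:
  assumes "pos n (r, c) - n < s" "s < pos n (r, c)" "1 \<le> r" "r \<le> n" "1 \<le> c"
  shows "snd (cell n s) = c \<and> r < fst (cell n s) \<or> Suc (snd (cell n s)) = c \<and> fst (cell n s) < r"
proof -
  obtain r' c' where rc: "cell n s = (r', c')" by fastforce
  have n: "1 \<le> n" using assms by simp
  have r': "1 \<le> r'" "r' \<le> n" and s: "s = c' * n + (n - r')"
    using cell_row[OF n, of s] pos_cell[OF n, of s] rc by (auto simp: pos_def)
  obtain c0 where c0: "c = Suc c0" using assms by (cases c) auto
  have bounds: "c0 * n + (n - r) < c' * n + (n - r')" "c' * n + (n - r') < c0 * n + n + (n - r)"
    using assms s by (auto simp: pos_def c0)
  have "c' < c0 + 2"
  proof (rule ccontr)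
    assume "\<not> c' < c0 + 2"
    then have "(c0 + 2) * n \<le> c' * n" by (intro mult_right_mono) auto
    then show False using bounds assms by auto
  qed
  moreover have "c0 \<le> c'"
  proof (rule ccontr)
    assume "\<not> c0 \<le> c'"
    then have "Suc c' * n \<le> c0 * n" by (intro mult_right_mono) auto
    then show False using bounds r' by auto
  qed
  ultimately consider "c' = c0" | "c' = Suc c0" by linarith
  then show ?thesis
    using bounds r' assms by cases (auto simp: rc c0)
qed

lemma pos_window_same_col:
  "r < r' \<Longrightarrow> r' \<le> n \<Longrightarrow> 1 \<le> r \<Longrightarrow> 1 \<le> c \<Longrightarrow> pos n (r', c) \<in> {pos n (r, c) - n<..<pos n (r, c)}"
  by (cases c) (auto simp: pos_def)

lemma pos_window_prev_col:
  "r' < r \<Longrightarrow> r \<le> n \<Longrightarrow> 1 \<le> r' \<Longrightarrow> 1 \<le> c \<Longrightarrow> pos n (r', c - 1) \<in> {pos n (r, c) - n<..<pos n (r, c)}"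
  by (cases c) (auto simp: pos_def)

section \<open>Finiteness of the sets of boxes and triples\<close>

lemma finite_aug_boxes: "finite (aug_boxes al)"
proof -
  have "aug_boxes al = Sigma {1..length al} (\<lambda>r. {..part al r})"
    by (auto simp: aug_boxes_def)
  then show ?thesis by simp
qed

lemma nb_subset_aug: "nb_boxes al \<subseteq> aug_boxes al"
  by (auto simp: nb_boxes_def aug_boxes_def)

lemma finite_nb_boxes: "finite (nb_boxes al)"
  using finite_subset[OF nb_subset_aug finite_aug_boxes] .

lemma finite_typeA: "finite (typeA al)"
proof -
  have "typeA al \<subseteq> (\<lambda>((r, c), r'). (r, c, r')) ` (nb_boxes al \<times> {..length al})"
    by (auto simp: typeA_def nb_boxes_def image_iff)
  then show ?thesis
    by (rule finite_subset) (simp add: finite_nb_boxes)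
qed

lemma finite_typeB: "finite (typeB al)"
proof -
  have "typeB al \<subseteq> (\<lambda>((r, c), r'). (r, c, r')) ` (nb_boxes al \<times> {..length al})"
    by (auto simp: typeB_def nb_boxes_def image_iff)
  then show ?thesis
    by (rule finite_subset) (simp add: finite_nb_boxes)
qed

section \<open>The coinversion statistic\<close>

text \<open>In a triple of a non-attacking filling, \<open>e\<close> attacks both \<open>a\<close>
  and \<open>b\<close>, so the only possible tie is between \<open>a\<close> and \<open>b\<close>.
  Sums on both sides avoid subtraction of naturals.\<close>

lemma coinversion_count:
  assumes "a \<noteq> e" "b \<noteq> e"
  shows "of_bool (\<not> is_inversion_triple a b e) + of_bool (b \<le> a) = (of_bool (e < a) + of_bool (b < e) :: nat)"
  using assms by (auto simp: is_inversion_triple_def tlt_def Let_def)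

definition box_inv :: "nat \<Rightarrow> (nat \<times> nat \<Rightarrow> nat) \<Rightarrow> nat \<times> nat \<Rightarrow> nat" where
  "box_inv n F u = card {s \<in> {pos n u - n<..<pos n u}. F u < F (cell n s)}"

text \<open>The lengths of the two rows decide which triple contains a box and one attacking it: the
  box is its \<open>b\<close> (first and third set) or its \<open>e\<close> (second and fourth). The
  window meets each other row exactly once, so it can be counted by rows; positions outside the
  diagram hold 0 and never exceed an entry.\<close>

lemma box_inv_split:
  assumes "(r, c) \<in> nb_boxes al" and supp: "\<And>u. u \<notin> aug_boxes al \<Longrightarrow> F u = 0"
  shows "box_inv (length al) F (r, c) =
      card {r'. (r, c, r') \<in> typeA al \<and> F (r, c) < F (r', c)} +
      card {r'. (r', Suc c, r) \<in> typeB al \<and> F (r, c) < F (r', c)} +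
      card {r'. (r, c, r') \<in> typeB al \<and> F (r, c) < F (r', c - 1)} +
      card {r'. (r', c, r) \<in> typeA al \<and> F (r, c) < F (r', c - 1)}"
    (is "_ = card ?X1 + card ?X2 + card ?X3 + card ?X4")
proof -
  define n where "n = length al"
  have rc: "1 \<le> r" "r \<le> n" "1 \<le> c" "c \<le> part al r"
    using assms(1) by (auto simp: nb_boxes_def n_def)
  define S where "S = {s \<in> {pos n (r, c) - n<..<pos n (r, c)}. F (r, c) < F (cell n s)}"
  have fin: "finite ?X1" "finite ?X2" "finite ?X3" "finite ?X4"
    by ((rule finite_subset[of _ "{..n}"], auto simp: typeA_def typeB_def n_def)[1])+
  define row_pos where "row_pos = (\<lambda>r'. if r < r' then pos n (r', c) else pos n (r', c - 1))"
  have "bij_betw (\<lambda>s. fst (cell n s)) S (?X1 \<union> ?X2 \<union> (?X3 \<union> ?X4))"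
  proof (rule bij_betw_byWitness[of _ row_pos])
    have row_cases: "fst (cell n s) = r' \<Longrightarrow> (r < r' \<and> cell n s = (r', c)) \<or> (r' < r \<and> cell n s = (r', c - 1))"
      if "s \<in> S" for s r'
      using pos_window_cases[of n r c s] that rc by (auto simp: S_def prod_eq_iff)
    show "\<forall>s\<in>S. row_pos (fst (cell n s)) = s"
    proof
      fix s assume "s \<in> S"
      from row_cases[OF this refl] pos_cell[of n s] rc show "row_pos (fst (cell n s)) = s"
        by (auto simp: row_pos_def)
    qed
    have X: "r' \<in> ?X1 \<union> ?X2 \<union> (?X3 \<union> ?X4) \<longleftrightarrow> 1 \<le> r' \<and> r' \<le> n \<and>
       ((r < r' \<and> c \<le> part al r' \<and> F (r, c) < F (r', c)) \<or>
        (r' < r \<and> c - 1 \<le> part al r' \<and> F (r, c) < F (r', c - 1)))" for r'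
      using rc unfolding typeA_def typeB_def n_def by auto
    show "\<forall>r'\<in>?X1 \<union> ?X2 \<union> (?X3 \<union> ?X4). fst (cell n (row_pos r')) = r'"
      unfolding X Ball_def by (auto simp: row_pos_def cell_pos)
    show "(\<lambda>s. fst (cell n s)) ` S \<subseteq> ?X1 \<union> ?X2 \<union> (?X3 \<union> ?X4)"
    proof
      fix r' assume "r' \<in> (\<lambda>s. fst (cell n s)) ` S"
      then obtain s where s: "s \<in> S" "fst (cell n s) = r'" by auto
      then have lt: "F (r, c) < F (cell n s)" by (simp add: S_def)
      then have "F (cell n s) \<noteq> 0" by simp
      then have "cell n s \<in> aug_boxes al" using supp[of "cell n s"] by auto
      then show "r' \<in> ?X1 \<union> ?X2 \<union> (?X3 \<union> ?X4)"
        unfolding X using row_cases[OF s] lt by (elim disjE) (simp_all add: aug_boxes_def n_def)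
    qed
    show "row_pos ` (?X1 \<union> ?X2 \<union> (?X3 \<union> ?X4)) \<subseteq> S"
    proof
      fix s assume "s \<in> row_pos ` (?X1 \<union> ?X2 \<union> (?X3 \<union> ?X4))"
      then obtain r' where "r' \<in> ?X1 \<union> ?X2 \<union> (?X3 \<union> ?X4)" and s: "s = row_pos r'" by blast
      then show "s \<in> S"
        unfolding X s S_def row_pos_def
        using pos_window_same_col[of r r' n c] pos_window_prev_col[of r' r n c] rc
        by (auto simp: cell_pos)
    qed
  qed
  then have "card S = card (?X1 \<union> ?X2 \<union> (?X3 \<union> ?X4))"
    by (rule bij_betw_same_card)
  also have "\<dots> = card (?X1 \<union> ?X2) + card (?X3 \<union> ?X4)"
    using fin by (intro card_Un_disjoint) (auto simp: typeA_def typeB_def)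
  also have "card (?X1 \<union> ?X2) = card ?X1 + card ?X2"
    using fin by (intro card_Un_disjoint) (auto simp: typeA_def typeB_def)
  also have "card (?X3 \<union> ?X4) = card ?X3 + card ?X4"
    using fin by (intro card_Un_disjoint) (auto simp: typeA_def typeB_def)
  finally show ?thesis
    by (simp add: box_inv_def S_def n_def)
qed

lemma sum_card_fibres:
  assumes "finite A" "\<And>u. u \<in> A \<Longrightarrow> finite (X u)" "bij_betw f (Sigma A X) T"
  shows "(\<Sum>u\<in>A. card (X u)) = card T"
  using assms card_SigmaI[of A X] bij_betw_same_card[OF assms(3)] by simp

lemma arm_eq_fibres:
  "arm al (r, c) = card {r'. r < r' \<and> r' \<le> length al \<and> c \<le> part al r' \<and> part al r' \<le> part al r} +
    card {r'. 1 \<le> r' \<and> r' < r \<and> c - 1 \<le> part al r' \<and> part al r' < part al r}"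
  by (simp add: arm_def)

text \<open>Type B triples with c = 1 contain the two basement boxes a and e; their inversions do not depend on the
  filling.\<close>

definition basement_const :: "nat list \<Rightarrow> nat list \<Rightarrow> nat" where
  "basement_const sigma al = card {(r, c, r') \<in> typeB al. c = 1 \<and> sigma ! (r' - 1) < sigma ! (r - 1)}"

text \<open>This sums \<open>coinversion_count\<close> over all triples. A box is the
  \<open>b\<close> of exactly \<open>arm\<close> many triples, so the terms with
  \<open>b \<le> a\<close> give the arms of the non-descents. The inverted pairs are counted by
  \<open>box_inv_split\<close>, except those between two basement boxes.\<close>

lemma coinv_eq_box_inv:
  assumes F: "F \<in> NAF sigma al"
  shows "coinv al F + (\<Sum>u\<in>{u \<in> nb_boxes al. \<not> is_descent F u}. arm al u) =
     basement_const sigma al + (\<Sum>u\<in>nb_boxes al. box_inv (length al) F u)"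
proof -
  let ?A = "typeA al" and ?B = "typeB al" and ?N = "nb_boxes al"
  have supp: "\<And>u. u \<notin> aug_boxes al \<Longrightarrow> F u = 0"
    and base: "\<And>r. r \<in> {1..length al} \<Longrightarrow> F (r, 0) = sigma ! (r - 1)"
    and na: "non_attacking al F"
    using F by (auto simp: NAF_def)
  have attack: "F (r, c) \<noteq> F (r', c')"
    if "(r, c) \<in> aug_boxes al" "(r', c') \<in> aug_boxes al" "(r, c) \<noteq> (r', c')"
      "c = c' \<or> c' = c + 1 \<and> r < r'" for r c r' c'
    using na that unfolding non_attacking_def by blast
  have A_id: "of_bool (\<not> is_inversion_triple (F (r, c - 1)) (F (r, c)) (F (r', c))) + of_bool (F (r, c) \<le> F (r, c - 1))
     = (of_bool (F (r', c) < F (r, c - 1)) + of_bool (F (r, c) < F (r', c)) :: nat)"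
    if "(r, c, r') \<in> ?A" for r c r'
    using that by (intro coinversion_count attack) (auto simp: typeA_def aug_boxes_def)
  have B_id: "of_bool (\<not> is_inversion_triple (F (r, c - 1)) (F (r, c)) (F (r', c - 1))) + of_bool (F (r, c) \<le> F (r, c - 1))
     = (of_bool (F (r', c - 1) < F (r, c - 1)) + of_bool (F (r, c) < F (r', c - 1)) :: nat)"
    if "(r, c, r') \<in> ?B" for r c r'
  proof (rule coinversion_count)
    show "F (r, c - 1) \<noteq> F (r', c - 1)"
      using that by (intro attack) (auto simp: typeB_def aug_boxes_def)
    have "F (r', c - 1) \<noteq> F (r, c)"
      using that by (intro attack) (auto simp: typeB_def aug_boxes_def)
    then show "F (r, c) \<noteq> F (r', c - 1)" by simp
  qed
  have card_sum: "card {(r, c, r') \<in> T. Q r c r'} = (\<Sum>(r, c, r')\<in>T. of_bool (Q r c r'))"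
    if "finite T" for T :: "(nat \<times> nat \<times> nat) set" and Q
  proof -
    have "{(r, c, r') \<in> T. Q r c r'} = T \<inter> {(r, c, r'). Q r c r'}" by auto
    then show ?thesis using that by (simp add: case_prod_unfold)
  qed
  have SA: "card {(r, c, r') \<in> ?A. \<not> is_inversion_triple (F (r, c - 1)) (F (r, c)) (F (r', c))}
      + card {(r, c, r') \<in> ?A. F (r, c) \<le> F (r, c - 1)}
     = card {(r, c, r') \<in> ?A. F (r', c) < F (r, c - 1)} + card {(r, c, r') \<in> ?A. F (r, c) < F (r', c)}"
    unfolding card_sum[OF finite_typeA] sum.distrib[symmetric]
    by (rule sum.cong) (use A_id in \<open>auto\<close>)
  have SB: "card {(r, c, r') \<in> ?B. \<not> is_inversion_triple (F (r, c - 1)) (F (r, c)) (F (r', c - 1))}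
      + card {(r, c, r') \<in> ?B. F (r, c) \<le> F (r, c - 1)}
     = card {(r, c, r') \<in> ?B. F (r', c - 1) < F (r, c - 1)} + card {(r, c, r') \<in> ?B. F (r, c) < F (r', c - 1)}"
    unfolding card_sum[OF finite_typeB] sum.distrib[symmetric]
    by (rule sum.cong) (use B_id in \<open>auto\<close>)
  define AS where "AS = (\<lambda>(r, c). {r'. r < r' \<and> r' \<le> length al \<and> c \<le> part al r' \<and> part al r' \<le> part al r})"
  define BS where "BS = (\<lambda>(r, c). {r'. 1 \<le> r' \<and> r' < r \<and> c - 1 \<le> part al r' \<and> part al r' < part al r})"
  have fin: "finite (AS u)" "finite (BS u)" for u
    by ((rule finite_subset[of _ "{..max (length al) (fst u)}"], auto simp: AS_def BS_def)[1])+
  have arms: "(\<Sum>u\<in>{u \<in> ?N. \<not> is_descent F u}. arm al u) =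
      card {(r, c, r') \<in> ?A. F (r, c) \<le> F (r, c - 1)} + card {(r, c, r') \<in> ?B. F (r, c) \<le> F (r, c - 1)}"
  proof -
    have "(\<Sum>u\<in>{u \<in> ?N. \<not> is_descent F u}. card (AS u)) = card {(r, c, r') \<in> ?A. F (r, c) \<le> F (r, c - 1)}"
      by (rule sum_card_fibres[where f = "\<lambda>((r, c), r'). (r, c, r')"], simp add: finite_nb_boxes, rule fin,
        rule bij_betw_byWitness[where f' = "\<lambda>(r, c, r'). ((r, c), r')"])
      (auto simp: AS_def nb_boxes_def typeA_def is_descent_def)
    moreover have "(\<Sum>u\<in>{u \<in> ?N. \<not> is_descent F u}. card (BS u)) = card {(r, c, r') \<in> ?B. F (r, c) \<le> F (r, c - 1)}"
      by (rule sum_card_fibres[where f = "\<lambda>((r, c), r'). (r, c, r')"], simp add: finite_nb_boxes, rule fin,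
        rule bij_betw_byWitness[where f' = "\<lambda>(r, c, r'). ((r, c), r')"])
      (auto simp: BS_def nb_boxes_def typeB_def is_descent_def)
    moreover have "arm al u = card (AS u) + card (BS u)" for u
      by (cases u) (simp add: arm_eq_fibres AS_def BS_def)
    ultimately show ?thesis by (simp add: sum.distrib)
  qed
  define X1 where "X1 = (\<lambda>(r, c). {r'. (r, c, r') \<in> ?A \<and> F (r, c) < F (r', c)})"
  define X2 where "X2 = (\<lambda>(r, c). {r'. (r', Suc c, r) \<in> ?B \<and> F (r, c) < F (r', c)})"
  define X3 where "X3 = (\<lambda>(r, c). {r'. (r, c, r') \<in> ?B \<and> F (r, c) < F (r', c - 1)})"
  define X4 where "X4 = (\<lambda>(r, c). {r'. (r', c, r) \<in> ?A \<and> F (r, c) < F (r', c - 1)})"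
  have fin: "finite (X1 u)" "finite (X2 u)" "finite (X3 u)" "finite (X4 u)" for u
    by ((rule finite_subset[of _ "{..length al}"],
        auto simp: X1_def X2_def X3_def X4_def typeA_def typeB_def)[1])+
  have "(\<Sum>u\<in>?N. box_inv (length al) F u) = (\<Sum>u\<in>?N. card (X1 u) + card (X2 u) + card (X3 u) + card (X4 u))"
    by (rule sum.cong) (auto simp: X1_def X2_def X3_def X4_def box_inv_split supp)
  also have "\<dots> = (\<Sum>u\<in>?N. card (X1 u)) + (\<Sum>u\<in>?N. card (X2 u)) + (\<Sum>u\<in>?N. card (X3 u)) + (\<Sum>u\<in>?N. card (X4 u))"
    by (simp add: sum.distrib)
  also have "(\<Sum>u\<in>?N. card (X1 u)) = card {(r, c, r') \<in> ?A. F (r, c) < F (r', c)}"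
    by (rule sum_card_fibres[where f = "\<lambda>((r, c), r'). (r, c, r')"], simp add: finite_nb_boxes, rule fin,
        rule bij_betw_byWitness[where f' = "\<lambda>(r, c, r'). ((r, c), r')"])
      (auto simp: X1_def nb_boxes_def typeA_def)
  also have "(\<Sum>u\<in>?N. card (X3 u)) = card {(r, c, r') \<in> ?B. F (r, c) < F (r', c - 1)}"
    by (rule sum_card_fibres[where f = "\<lambda>((r, c), r'). (r, c, r')"], simp add: finite_nb_boxes, rule fin,
        rule bij_betw_byWitness[where f' = "\<lambda>(r, c, r'). ((r, c), r')"])
      (auto simp: X3_def nb_boxes_def typeB_def)
  also have "(\<Sum>u\<in>?N. card (X4 u)) = card {(r, c, r') \<in> ?A. F (r', c) < F (r, c - 1)}"
    by (rule sum_card_fibres[where f = "\<lambda>((r, c), r'). (r', c, r)"], simp add: finite_nb_boxes, rule fin,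
        rule bij_betw_byWitness[where f' = "\<lambda>(r, c, r'). ((r', c), r)"])
      (auto simp: X4_def nb_boxes_def typeA_def)
  \<comment> \<open>Here \<open>Suc c\<close> is at least 2, so the triples with \<open>a\<close>
    and \<open>e\<close> both in the basement are missed; \<open>basement_const\<close> adds them
    back below.\<close>
  also have "(\<Sum>u\<in>?N. card (X2 u)) = card {(r, c, r') \<in> ?B. c \<noteq> 1 \<and> F (r', c - 1) < F (r, c - 1)}"
  proof (rule sum_card_fibres[where f = "\<lambda>((r, c), r'). (r', Suc c, r)"])
    show "bij_betw (\<lambda>((r, c), r'). (r', Suc c, r)) (Sigma ?N X2)
        {(r, c, r') \<in> ?B. c \<noteq> 1 \<and> F (r', c - 1) < F (r, c - 1)}"
      by (rule bij_betw_byWitness[where f' = "\<lambda>(r, c, r'). ((r', c - 1), r)"])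
        (auto simp: X2_def nb_boxes_def typeB_def)
  qed (use fin finite_nb_boxes in auto)
  finally have inv: "(\<Sum>u\<in>?N. box_inv (length al) F u) =
      card {(r, c, r') \<in> ?A. F (r, c) < F (r', c)} +
      card {(r, c, r') \<in> ?B. c \<noteq> 1 \<and> F (r', c - 1) < F (r, c - 1)} +
      card {(r, c, r') \<in> ?B. F (r, c) < F (r', c - 1)} +
      card {(r, c, r') \<in> ?A. F (r', c) < F (r, c - 1)}" .
  have "card {(r, c, r') \<in> ?B. F (r', c - 1) < F (r, c - 1)} =
      card ({(r, c, r') \<in> ?B. c = 1 \<and> sigma ! (r' - 1) < sigma ! (r - 1)} \<union>
        {(r, c, r') \<in> ?B. c \<noteq> 1 \<and> F (r', c - 1) < F (r, c - 1)})"
    by (rule arg_cong[where f = card]) (auto simp: base typeB_def)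
  also have "\<dots> = basement_const sigma al + card {(r, c, r') \<in> ?B. c \<noteq> 1 \<and> F (r', c - 1) < F (r, c - 1)}"
    unfolding basement_const_def
    by (rule card_Un_disjoint) (auto intro: finite_subset[OF _ finite_typeB])
  finally show ?thesis
    using SA SB arms inv unfolding coinv_def by linarith
qed

section \<open>Expansion of the partition function over fillings\<close>

context scan
begin

text \<open>The completions enumerated by \<open>W\<close>, in closed form: the exclusion refers to
  \<open>F\<close> itself, which makes the comparison with \<open>NAF\<close> direct.\<close>

definition ext :: "nat \<Rightarrow> nat \<Rightarrow> (nat \<Rightarrow> nat) \<Rightarrow> (nat \<Rightarrow> nat) set" where
  "ext m p g = {F. (\<forall>r. r \<notin> {p..<p + m} \<longrightarrow> F r = g r) \<and>
     (\<forall>r\<in>{p..<p + m}. if P r then F r \<in> {1..n} - F ` {r - n<..<r} else F r = 0)}"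

lemma ext_Suc:
  "ext (Suc m) p g = (\<Union>b\<in>(if P p then {1..n} - g ` {p - n<..<p} else {0}). ext m (Suc p) (g(p := b)))"
proof (intro set_eqI iffI)
  fix F assume F: "F \<in> ext (Suc m) p g"
  have on: "\<forall>r\<in>{p..<p + Suc m}. if P r then F r \<in> {1..n} - F ` {r - n<..<r} else F r = 0"
    and off: "\<And>r. r \<notin> {p..<p + Suc m} \<Longrightarrow> F r = g r"
    using F unfolding ext_def by blast+
  have img: "F ` {p - n<..<p} = g ` {p - n<..<p}"
    by (intro image_cong off) auto
  have "F p \<in> (if P p then {1..n} - g ` {p - n<..<p} else {0})"
  proof -
    from on have "if P p then F p \<in> {1..n} - F ` {p - n<..<p} else F p = 0"
      by (rule bspec) simp
    then show ?thesis
      unfolding img by (cases "P p") simp_all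
  qed
  moreover have "F \<in> ext m (Suc p) (g(p := F p))"
    unfolding ext_def mem_Collect_eq
  proof (intro conjI allI impI ballI)
    fix r assume "r \<notin> {Suc p..<Suc p + m}"
    then show "F r = (g(p := F p)) r"
      using off[of r] by (cases "r = p") auto
  next
    fix r assume "r \<in> {Suc p..<Suc p + m}"
    then show "if P r then F r \<in> {1..n} - F ` {r - n<..<r} else F r = 0"
      by (intro on[THEN bspec]) auto
  qed
  ultimately show "F \<in> (\<Union>b\<in>(if P p then {1..n} - g ` {p - n<..<p} else {0}). ext m (Suc p) (g(p := b)))"
    by blast
next
  fix F assume "F \<in> (\<Union>b\<in>(if P p then {1..n} - g ` {p - n<..<p} else {0}). ext m (Suc p) (g(p := b)))"
  then obtain b where b: "b \<in> (if P p then {1..n} - g ` {p - n<..<p} else {0})"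
    and F: "F \<in> ext m (Suc p) (g(p := b))" by blast
  have Fp: "F p = b" using F by (auto simp: ext_def)
  have img: "F ` {p - n<..<p} = g ` {p - n<..<p}"
    using F by (intro image_cong) (auto simp: ext_def)
  have "if P r then F r \<in> {1..n} - F ` {r - n<..<r} else F r = 0" if "r \<in> {p..<p + Suc m}" for r
  proof (cases "r = p")
    case True
    then show ?thesis using b Fp img by auto
  next
    case False
    then have "r \<in> {Suc p..<Suc p + m}" using that by auto
    moreover have "\<forall>r\<in>{Suc p..<Suc p + m}. if P r then F r \<in> {1..n} - F ` {r - n<..<r} else F r = 0"
      using F unfolding ext_def by blast
    ultimately show ?thesis by blast
  qed
  moreover have "F r = g r" if "r \<notin> {p..<p + Suc m}" for r
  proof -
    have "r \<notin> {Suc p..<Suc p + m}" "r \<noteq> p" using that by auto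
    then show ?thesis using F by (simp add: ext_def)
  qed
  ultimately show "F \<in> ext (Suc m) p g"
    unfolding ext_def by blast
qed

lemma ext_apply:
  assumes "F \<in> ext m p g" "r < p"
  shows "F r = g r"
  using assms by (simp add: ext_def)

lemma finite_ext: "finite (ext m p g)"
proof (induction m arbitrary: p g)
  case 0
  have "ext 0 p g = {g}" by (auto simp: ext_def)
  then show ?case by simp
next
  case (Suc m)
  then show ?case unfolding ext_Suc by simp
qed

lemma W_eq_sum_ext:
  assumes "1 \<le> n" "1 \<le> p"
  shows "W x m p g = (\<Sum>F\<in>ext m p g. \<Prod>r\<in>{r \<in> {p..<p + m}. P r}. step x r F (F r))"
  using assms(2)
proof (induction m arbitrary: p g)
  case 0
  have "ext 0 p g = {g}" by (auto simp: ext_def)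
  then show ?case by simp
next
  case (Suc m)
  define B where "B = (if P p then {1..n} - g ` {p - n<..<p} else {0})"
  define w where "w = (\<lambda>q k F. \<Prod>r\<in>{r \<in> {q..<q + k}. P r}. step x r F (F r))"
  have Fp: "F p = b" if "F \<in> ext m (Suc p) (g(p := b))" for F b
    using that ext_apply[OF that, of p] by simp
  \<comment> \<open>Apart from the new entry, the step at \<open>p\<close> reads only earlier
    positions, where \<open>F\<close> agrees with \<open>g\<close>.\<close>
  have stepF: "step x p F (F p) = step x p g b" if F: "F \<in> ext m (Suc p) (g(p := b))" for F b
  proof -
    have "F s = g s" if "s < p" for s
      using ext_apply[OF F, of s] that by simp
    then have "{s \<in> {p - n<..<p}. b < F s} = {s \<in> {p - n<..<p}. b < g s}" "F (p - n) = g (p - n)"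
      using assms(1) Suc.prems by auto
    then show ?thesis using Fp[OF F] by (simp add: step_def)
  qed
  have w_Suc: "w p (Suc m) F = (if P p then step x p g b else 1) * w (Suc p) m F"
    if F: "F \<in> ext m (Suc p) (g(p := b))" for F b
  proof -
    have "{r \<in> {p..<p + Suc m}. P r} = (if P p then insert p else id) {r \<in> {Suc p..<Suc p + m}. P r}"
      by (auto simp: less_Suc_eq_le Suc_le_eq le_less)
    then show ?thesis using stepF[OF F] by (simp add: w_def)
  qed
  have "(\<Sum>F\<in>ext (Suc m) p g. w p (Suc m) F) = (\<Sum>b\<in>B. \<Sum>F\<in>ext m (Suc p) (g(p := b)). w p (Suc m) F)"
    unfolding ext_Suc B_def[symmetric]
  proof (rule sum.UNION_disjoint)
    show "finite B" by (simp add: B_def)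
    show "\<forall>b\<in>B. finite (ext m (Suc p) (g(p := b)))" by (simp add: finite_ext)
    show "\<forall>b\<in>B. \<forall>b'\<in>B. b \<noteq> b' \<longrightarrow> ext m (Suc p) (g(p := b)) \<inter> ext m (Suc p) (g(p := b')) = {}"
      using Fp by blast
  qed
  also have "\<dots> = (\<Sum>b\<in>B. (if P p then step x p g b else 1) * W x m (Suc p) (g(p := b)))"
  proof (rule sum.cong[OF refl])
    fix b
    have "W x m (Suc p) (g(p := b)) = sum (w (Suc p) m) (ext m (Suc p) (g(p := b)))"
      unfolding w_def by (rule Suc.IH) simp
    then show "(\<Sum>F\<in>ext m (Suc p) (g(p := b)). w p (Suc m) F) =
        (if P p then step x p g b else 1) * W x m (Suc p) (g(p := b))"
      by (simp only: sum_distrib_left) (rule sum.cong[OF refl w_Suc])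
  qed
  also have "\<dots> = W x (Suc m) p g"
    by (simp add: B_def)
  finally show ?case by (simp add: w_def)
qed

text \<open>On the basement window, exchanging the two rows has the same effect as exchanging the
  two labels. Hence \<open>W\<close> takes equal values at both members of a Hecke pair.\<close>

lemma W_symmetric:
  fixes x :: "nat \<Rightarrow> 'a" and i :: nat
  defines "\<tau> \<equiv> transpose i (Suc i)"
  assumes i: "1 \<le> i" "Suc i \<le> n" and p0: "Suc p0 < n"
    and P: "\<And>c. P (Suc (p0 + c * n)) \<longleftrightarrow> P (p0 + c * n)"
    and y: "\<And>c. 1 \<le> c \<Longrightarrow> P (p0 + c * n) \<Longrightarrow> y (Suc (p0 + c * n)) = t * y (p0 + c * n)"
    and nz: "\<And>p. P p \<Longrightarrow> 1 - t * y p \<noteq> 0"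
    and t: "t ^ 2 \<noteq> 1"
    and g: "inj_on g {0..<n}" "{g p0, g (Suc p0)} = {i, Suc i}"
  shows "W x (n * C) n g = W (x \<circ> \<tau>) (n * C) n g"
proof -
  \<comment> \<open>\<open>label_swap\<close> expects i to be the later of the two labels, so the
    labels are exchanged first if necessary.\<close>
  define h where "h = (if g (Suc p0) = i then g else \<tau> \<circ> g)"
  have \<tau>_inj: "\<tau> v = \<tau> w \<longleftrightarrow> v = w" for v w
    by (auto simp: \<tau>_def transpose_def split: if_splits)
  have h: "h (Suc p0) = i" "h p0 = Suc i"
    using g(2) by (auto simp: h_def \<tau>_def doubleton_eq_iff)
  have h_inj: "inj_on h {0..<n}"
    using g(1) \<tau>_inj by (auto simp: h_def inj_on_def)
  have other: "h r \<noteq> i" "h r \<noteq> Suc i" if "r < n" "r \<noteq> p0" "r \<noteq> Suc p0" for r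
    using inj_onD[OF h_inj, of r "Suc p0"] inj_onD[OF h_inj, of r p0] that p0 h by auto
  have swap: "W z (n * C) n h = W z (n * C) n (\<tau> \<circ> h)" for z
  proof -
    have "W z (n * C) n h = W z (n * C) n (h \<circ> transpose p0 (Suc p0))"
      \<comment> \<open>The scan starts at position \<open>n\<close> with the pair in column 0 and
        ends at \<open>(C + 1) * n\<close>.\<close>
      by (rule row_swap[OF p0 P y nz, where c = 0 and C = "Suc C"]) (use p0 in auto)
    also have "\<dots> = W z (n * C) n (\<tau> \<circ> h)"
    proof (rule W_window_cong)
      fix s assume "s \<in> {n - n..<n}"
      then show "(h \<circ> transpose p0 (Suc p0)) s = (\<tau> \<circ> h) s"
        using other[of s] h by (auto simp: transpose_def \<tau>_def)
    qed (use p0 in auto)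
    finally show ?thesis .
  qed
  have "hecke_rel t (x i) (x (Suc i)) (W x (n * C) n h) (W x (n * C) n (\<tau> \<circ> h))
         (W (x \<circ> \<tau>) (n * C) n h) (W (x \<circ> \<tau>) (n * C) n (\<tau> \<circ> h))"
    unfolding \<tau>_def
  proof (rule label_swap[OF i nz, THEN conjunct2, rule_format])
    show "inj_on h {s \<in> {n - n..<n}. h s \<in> {i, Suc i}}"
      by (rule inj_on_subset[OF h_inj]) auto
    show "Suc p0 \<in> {n - n..<n}" using p0 by simp
    show "h r \<notin> {i, Suc i}" if "r \<in> {Suc p0<..<n}" for r
      using other[of r] that by auto
  qed (use h in auto)
  then obtain A B where AB:
    "W x (n * C) n h = A + B * x (Suc i)" "W x (n * C) n h = A + t * B * x i"
    "W (x \<circ> \<tau>) (n * C) n h = A + B * x i" "W (x \<circ> \<tau>) (n * C) n h = A + t * B * x (Suc i)"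
    unfolding hecke_rel_def swap[symmetric] by blast
  have e: "B * x (Suc i) = t * (B * x i)" "B * x i = t * (B * x (Suc i))"
    using AB by auto
  then have "(t ^ 2 - 1) * (B * x i) = 0" "(t ^ 2 - 1) * (B * x (Suc i)) = 0"
    by algebra+
  then have zero: "B * x i = 0" "B * x (Suc i) = 0"
    using t by auto
  have "W x (n * C) n h = W (x \<circ> \<tau>) (n * C) n h"
    by (simp only: AB(1,3) zero)
  moreover have "W z (n * C) n h = W z (n * C) n g" for z
    using swap[of z] unfolding h_def
    by (cases "g (Suc p0) = i") (auto simp: comp_assoc[symmetric] \<tau>_def)
  ultimately show ?thesis by simp
qed

end

section \<open>The Macdonald polynomial as a partition function\<close>

definition in_diagram :: "nat list \<Rightarrow> nat \<Rightarrow> bool" where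
  "in_diagram al p \<longleftrightarrow> cell (length al) p \<in> aug_boxes al"

text \<open>One factor \<open>t\<close> short of the monomial in the denominator, as
  \<open>wt\<close> expects.\<close>

definition box_wt :: "nat list \<Rightarrow> 'a::field \<Rightarrow> 'a \<Rightarrow> nat \<times> nat \<Rightarrow> 'a" where
  "box_wt al q t u = q ^ (1 + leg al u) * t ^ arm al u"

text \<open>Column 0 is read from the bottom row upwards, so \<open>sigma\<close> appears reversed;
  the value 0 beyond it matches the positions after the scanned range.\<close>

definition basement :: "nat list \<Rightarrow> nat \<Rightarrow> nat" where
  "basement sigma r = (if r < length sigma then sigma ! (length sigma - 1 - r) else 0)"

text \<open>No part exceeds the sum of all parts, so \<open>length al * sum_list al\<close>
  positions after the basement exhaust the diagram. This length is also a multiple of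
  \<open>length al\<close>, as \<open>row_swap\<close> requires.\<close>

lemma in_diagram_bound:
  assumes "in_diagram al p"
  shows "p < length al + length al * sum_list al"
proof -
  let ?n = "length al"
  have rc: "1 \<le> ?n" "p div ?n \<le> part al (?n - p mod ?n)" and idx: "?n - p mod ?n - 1 < ?n"
    using assms by (auto simp: in_diagram_def aug_boxes_def cell_def)
  have "part al (?n - p mod ?n) \<le> sum_list al"
    unfolding Defs.part_def by (rule member_le_sum_list[OF nth_mem[OF idx]]) simp
  then have "p div ?n < Suc (sum_list al)"
    using rc by linarith
  then have "p < Suc (sum_list al) * ?n"
    using rc(1) div_less_iff_less_mult[of ?n p "Suc (sum_list al)"] by linarith
  then show ?thesis by (simp add: algebra_simps)
qed

lemma nb_boxes_conv_pos:
  assumes "1 \<le> length al"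
  shows "bij_betw (cell (length al))
    {p \<in> {length al..<length al + length al * sum_list al}. in_diagram al p} (nb_boxes al)"
proof (rule bij_betw_byWitness[where f' = "pos (length al)"])
  let ?n = "length al"
  let ?S = "{p \<in> {?n..<?n + ?n * sum_list al}. in_diagram al p}"
  show "\<forall>p\<in>?S. pos ?n (cell ?n p) = p"
    using assms by (simp add: pos_cell)
  show "\<forall>u\<in>nb_boxes al. cell ?n (pos ?n u) = u"
    by (auto simp: nb_boxes_def cell_pos)
  show "cell ?n ` ?S \<subseteq> nb_boxes al"
  proof
    fix u assume "u \<in> cell ?n ` ?S"
    then obtain p where p: "?n \<le> p" "cell ?n p \<in> aug_boxes al" "u = cell ?n p"
      by (auto simp: in_diagram_def)
    have "1 \<le> p div ?n"
      using p(1) assms by (simp add: Suc_le_eq div_greater_zero_iff)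
    then show "u \<in> nb_boxes al"
      using p by (auto simp: nb_boxes_def aug_boxes_def cell_def)
  qed
  show "pos ?n ` nb_boxes al \<subseteq> ?S"
  proof
    fix p assume "p \<in> pos ?n ` nb_boxes al"
    then obtain r c where rc: "(r, c) \<in> nb_boxes al" "p = pos ?n (r, c)" by auto
    have "cell ?n p = (r, c)"
      using rc by (auto simp: nb_boxes_def cell_pos)
    then have "in_diagram al p"
      using rc nb_subset_aug by (auto simp: in_diagram_def)
    moreover have "?n \<le> p"
      using rc by (cases c) (auto simp: nb_boxes_def pos_def)
    ultimately show "p \<in> ?S"
      using in_diagram_bound by auto
  qed
qed

text \<open>The exclusion in \<open>ext\<close> is the attack condition against earlier boxes.
  Column 0 lies before the scanned range, and its entries differ because \<open>sigma\<close> is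
  distinct.\<close>

lemma NAF_bij_ext:
  fixes sigma al :: "nat list"
  defines "n \<equiv> length al"
  assumes n: "1 \<le> n" and len: "length sigma = n" and dist: "distinct sigma" and set: "set sigma = {1..n}"
  shows "bij_betw (\<lambda>F p. F (cell n p)) (NAF sigma al)
     (scan.ext n (in_diagram al) (n * sum_list al) n (basement sigma))"
proof (rule bij_betw_byWitness[where f' = "\<lambda>G (r, c). if 1 \<le> r \<and> r \<le> n then G (pos n (r, c)) else 0"])
  let ?E = "scan.ext n (in_diagram al) (n * sum_list al) n (basement sigma)"
  let ?back = "\<lambda>G (r, c). if 1 \<le> r \<and> r \<le> n then G (pos n (r, c)) else (0::nat)"
  have sigma_range: "sigma ! k \<in> {1..n}" if "k < n" for k
    using set nth_mem[of k sigma] that len by auto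
  show "\<forall>F\<in>NAF sigma al. ?back (\<lambda>p. F (cell n p)) = F"
  proof
    fix F assume "F \<in> NAF sigma al"
    then have "\<And>u. u \<notin> aug_boxes al \<Longrightarrow> F u = 0" unfolding NAF_def by blast
    then show "?back (\<lambda>p. F (cell n p)) = F"
      by (auto simp: fun_eq_iff cell_pos aug_boxes_def n_def)
  qed
  show "\<forall>G\<in>?E. (\<lambda>p. ?back G (cell n p)) = G"
  proof
    fix G :: "nat \<Rightarrow> nat"
    have "?back G (cell n p) = G p" for p
      using cell_row[OF n, of p] pos_cell[OF n, of p] by (cases "cell n p") auto
    then show "(\<lambda>p. ?back G (cell n p)) = G" by blast
  qed
  show "(\<lambda>F p. F (cell n p)) ` NAF sigma al \<subseteq> ?E"
  proof
    fix G assume "G \<in> (\<lambda>F p. F (cell n p)) ` NAF sigma al"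
    then obtain F where F: "F \<in> NAF sigma al" and G: "G = (\<lambda>p. F (cell n p))" by blast
    have range: "\<And>u. u \<in> aug_boxes al \<Longrightarrow> F u \<in> {1..n}"
      and supp: "\<And>u. u \<notin> aug_boxes al \<Longrightarrow> F u = 0"
      and base: "\<And>r. r \<in> {1..n} \<Longrightarrow> F (r, 0) = sigma ! (r - 1)"
      and na: "non_attacking al F"
      using F by (auto simp: NAF_def n_def)
    show "G \<in> ?E"
      unfolding scan.ext_def mem_Collect_eq
    proof (intro conjI allI impI ballI)
      fix p assume p: "p \<notin> {n..<n + n * sum_list al}"
      show "G p = basement sigma p"
      proof (cases "p < n")
        case True
        then have "cell n p = (n - p, 0)" by (simp add: cell_def)
        then show ?thesis
          using base[of "n - p"] True by (simp add: G basement_def len)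
      next
        case False
        then have "\<not> in_diagram al p"
          using p in_diagram_bound[of al p] by (auto simp: n_def)
        then have "F (cell n p) = 0"
          using supp by (simp add: in_diagram_def n_def)
        then show ?thesis
          using False by (simp add: G basement_def len)
      qed
    next
      fix p assume p: "p \<in> {n..<n + n * sum_list al}"
      show "if in_diagram al p then G p \<in> {1..n} - G ` {p - n<..<p} else G p = 0"
      proof (cases "in_diagram al p")
        case False
        then show ?thesis
          using supp by (simp add: G in_diagram_def n_def)
      next
        case True
        then have u: "cell n p \<in> aug_boxes al" by (simp add: in_diagram_def n_def)
        obtain r c where rc: "cell n p = (r, c)" by fastforce
        have r: "1 \<le> r" "r \<le> n" and pp: "p = pos n (r, c)"
          using rc cell_row[OF n, of p] pos_cell[OF n, of p] by simp_all
        have "c = p div n" using rc by (simp add: cell_def)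
        then have c: "1 \<le> c"
          using p n by (simp add: div_greater_zero_iff Suc_le_eq)
        have "G s \<noteq> G p" if s: "s \<in> {p - n<..<p}" for s
        proof (cases "cell n s \<in> aug_boxes al")
          case False
          then show ?thesis using supp range[OF u] by (auto simp: G)
        next
          case s_in: True
          obtain r' c' where rc': "cell n s = (r', c')" by fastforce
          from pos_window_cases[of n r c s] s r c
          consider "c' = c" "r < r'" | "c = c' + 1" "r' < r"
            unfolding pp rc' by auto
          then show ?thesis
            using na[unfolded non_attacking_def, rule_format, of r' c' r c] s_in u
            unfolding G rc rc' by cases auto
        qed
        then have "G p \<notin> G ` {p - n<..<p}" by (metis imageE)
        moreover have "G p \<in> {1..n}" using range[OF u] by (simp add: G)
        ultimately show ?thesis using True by simp
      qed
    qed
  qed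
  show "?back ` ?E \<subseteq> NAF sigma al"
  proof
    fix F assume "F \<in> ?back ` ?E"
    then obtain G where G: "G \<in> ?E" and F: "F = ?back G" by blast
    have off: "G p = basement sigma p" if "p \<notin> {n..<n + n * sum_list al}" for p
      using G that unfolding scan.ext_def by blast
    have on: "if in_diagram al p then G p \<in> {1..n} - G ` {p - n<..<p} else G p = 0"
      if "p \<in> {n..<n + n * sum_list al}" for p
      using G that unfolding scan.ext_def by blast
    have on': "G p \<in> {1..n} - G ` {p - n<..<p}" if "n \<le> p" "in_diagram al p" for p
      using on[of p] that in_diagram_bound[of al p] by (simp add: n_def)
    have diag: "in_diagram al (pos n (r, c)) \<longleftrightarrow> c \<le> part al r" if "1 \<le> r" "r \<le> n" for r c
      using that unfolding in_diagram_def n_def[symmetric] cell_pos[OF that]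
      by (simp add: aug_boxes_def n_def)
    have base: "G (n - r) = sigma ! (r - 1)" if "1 \<le> r" "r \<le> n" for r
      using off[of "n - r"] that by (simp add: basement_def len)
    have attack: "G s \<noteq> G p" if "s \<in> {p - n<..<p}" "n \<le> p" "in_diagram al p" for s p
      using on'[OF that(2,3)] that(1) by (metis DiffD2 imageI)
    show "F \<in> NAF sigma al"
      unfolding NAF_def mem_Collect_eq n_def[symmetric]
    proof (intro conjI ballI allI impI)
      fix u assume u: "u \<in> aug_boxes al"
      obtain r c where rc: "u = (r, c)" "1 \<le> r" "r \<le> n" "c \<le> part al r"
        using u by (auto simp: aug_boxes_def n_def)
      show "F u \<in> {1..n}"
      proof (cases "c = 0")
        case True
        then show ?thesis
          using base[of r] sigma_range[of "r - 1"] rc by (simp add: F pos_def)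
      next
        case False
        then have "n \<le> pos n (r, c)" by (cases c) (auto simp: pos_def)
        then show ?thesis
          using on'[of "pos n (r, c)"] diag[of r c] rc by (simp add: F)
      qed
    next
      fix u assume u: "u \<notin> aug_boxes al"
      obtain r c where rc: "u = (r, c)" by fastforce
      show "F u = 0"
      proof (cases "1 \<le> r \<and> r \<le> n")
        case True
        then have nd: "\<not> in_diagram al (pos n (r, c))" and "c \<noteq> 0"
          using u diag[of r c] rc by (auto simp: aug_boxes_def n_def)
        then have "n \<le> pos n (r, c)" by (cases c) (auto simp: pos_def)
        then have "G (pos n (r, c)) = 0"
          using on[of "pos n (r, c)"] off[of "pos n (r, c)"] nd
          by (cases "pos n (r, c) < n + n * sum_list al") (auto simp: basement_def len)
        then show ?thesis by (simp add: F rc)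
      qed (auto simp: F rc)
    next
      fix r assume "r \<in> {1..n}"
      then show "F (r, 0) = sigma ! (r - 1)"
        using base[of r] by (simp add: F pos_def)
    next
      \<comment> \<open>Every attacking pair other than two basement boxes has a later box in a
        column \<open>c'\<close> at least 1, and the window of that box contains the other
        one.\<close>
      have step: "F (r, c) \<noteq> F (r', c')"
        if "(r, c) \<in> aug_boxes al" "(r', c') \<in> aug_boxes al" "1 \<le> c'"
          "c = c' \<and> r' < r \<or> c' = c + 1 \<and> r < r'" for r c r' c'
      proof -
        have rr: "1 \<le> r" "r \<le> n" "1 \<le> r'" "r' \<le> n" "c' \<le> part al r'"
          using that by (auto simp: aug_boxes_def n_def)
        have "pos n (r, c) \<in> {pos n (r', c') - n<..<pos n (r', c')}"
          using pos_window_same_col[of r' r n c'] pos_window_prev_col[of r r' n c'] that(3,4) rr by auto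
        moreover have "n \<le> pos n (r', c')" using that(3) by (cases c') (auto simp: pos_def)
        ultimately have "G (pos n (r, c)) \<noteq> G (pos n (r', c'))"
          using attack diag rr by blast
        then show ?thesis using rr by (simp add: F)
      qed
      show "non_attacking al F"
        unfolding non_attacking_def
      proof (intro allI impI)
        fix r c r' c'
        assume u: "(r, c) \<in> aug_boxes al" "(r', c') \<in> aug_boxes al" "(r, c) \<noteq> (r', c')"
          and eq: "F (r, c) = F (r', c')"
        have rr: "1 \<le> r" "r \<le> n" "1 \<le> r'" "r' \<le> n"
          using u by (auto simp: aug_boxes_def n_def)
        have "c \<noteq> c'"
        proof
          assume cc: "c = c'"
          then have "r \<noteq> r'" using u by auto
          show False
          proof (cases "c = 0")
            case True
            then have "sigma ! (r - 1) = sigma ! (r' - 1)"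
              using eq cc base[of r] base[of r'] rr by (simp add: F pos_def)
            moreover have "r - 1 < length sigma" "r' - 1 < length sigma" "r - 1 \<noteq> r' - 1"
              using rr \<open>r \<noteq> r'\<close> len by linarith+
            ultimately show False
              using nth_eq_iff_index_eq[OF dist] by blast
          next
            case False
            then show False
              using step[OF u(1,2)] step[OF u(2,1)] eq cc \<open>r \<noteq> r'\<close> by (auto simp: neq_iff)
          qed
        qed
        moreover have "\<not> (c' = c + 1 \<and> r < r')"
          using step[OF u(1,2)] eq by auto
        ultimately show "c \<noteq> c' \<and> \<not> (c' = c + 1 \<and> r < r')" by blast
      qed
    qed
  qed
qed

text \<open>The prefactor supplies the arms of all boxes. Those of the non-descents turn
  \<open>coinv\<close> into inversion counts by \<open>coinv_eq_box_inv\<close>; those of the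
  descents become the powers of \<open>t\<close> in \<open>box_wt\<close>.\<close>

lemma Emac_eq_W:
  fixes x :: "nat \<Rightarrow> 'a::field_char_0" and al sigma :: "nat list"
  defines "n \<equiv> length al"
  assumes n: "1 \<le> n" and len: "length sigma = n" and dist: "distinct sigma" and set: "set sigma = {1..n}"
  shows "t ^ (\<Sum>u\<in>nb_boxes al. arm al u) * Emac sigma al x q t =
    t ^ basement_const sigma al *
      scan.W n (in_diagram al) (\<lambda>p. box_wt al q t (cell n p)) t x (n * sum_list al) n (basement sigma)"
proof -
  let ?N = "nb_boxes al"
  interpret S: scan n "in_diagram al" "\<lambda>p. box_wt al q t (cell n p)" t .
  define m where "m = n * sum_list al"
  define w where "w = (\<lambda>F. \<Prod>u\<in>?N. x (F u) * t ^ box_inv n F u *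
     wt t (box_wt al q t u) (F (fst u, snd u - 1)) (F u))"
  have "S.W x m n (basement sigma) =
      (\<Sum>G\<in>S.ext m n (basement sigma). \<Prod>p\<in>{p \<in> {n..<n + m}. in_diagram al p}. S.step x p G (G p))"
    by (rule S.W_eq_sum_ext[OF n n])
  also have "\<dots> = (\<Sum>F\<in>NAF sigma al.
      \<Prod>p\<in>{p \<in> {n..<n + m}. in_diagram al p}. S.step x p (\<lambda>p. F (cell n p)) (F (cell n p)))"
    using NAF_bij_ext[of al sigma] n len dist set
    by (intro sum.reindex_bij_betw[symmetric]) (simp add: n_def m_def)
  also have "\<dots> = sum w (NAF sigma al)"
  proof (rule sum.cong[OF refl])
    fix F
    have "w F = (\<Prod>p\<in>{p \<in> {n..<n + m}. in_diagram al p}. x (F (cell n p)) * t ^ box_inv n F (cell n p) *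
        wt t (box_wt al q t (cell n p)) (F (fst (cell n p), snd (cell n p) - 1)) (F (cell n p)))"
      unfolding w_def using nb_boxes_conv_pos[of al] n
      by (intro prod.reindex_bij_betw[symmetric]) (simp add: n_def m_def)
    also have "\<dots> = (\<Prod>p\<in>{p \<in> {n..<n + m}. in_diagram al p}. S.step x p (\<lambda>p. F (cell n p)) (F (cell n p)))"
      by (rule prod.cong) (simp_all add: S.step_def box_inv_def pos_cell[OF n] cell_left)
    finally show "(\<Prod>p\<in>{p \<in> {n..<n + m}. in_diagram al p}. S.step x p (\<lambda>p. F (cell n p)) (F (cell n p))) = w F"
      by simp
  qed
  finally have W: "S.W x m n (basement sigma) = sum w (NAF sigma al)" .
  have "t ^ (\<Sum>u\<in>?N. arm al u) *
     ((\<Prod>u\<in>?N. x (F u)) * q ^ maj al F * t ^ coinv al F *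
        (\<Prod>u\<in>{u \<in> ?N. F u \<noteq> F (fst u, snd u - 1)}.
           (1 - t) / (1 - q ^ (1 + leg al u) * t ^ (1 + arm al u)))) = t ^ basement_const sigma al * w F"
    if F: "F \<in> NAF sigma al" for F
  proof -
    define D where "D = {u \<in> ?N. is_descent F u}"
    define K where "K = (\<Prod>u\<in>{u \<in> ?N. F u \<noteq> F (fst u, snd u - 1)}.
           (1 - t) / (1 - q ^ (1 + leg al u) * t ^ (1 + arm al u)))"
    have split: "(\<Sum>u\<in>?N. arm al u) = (\<Sum>u\<in>D. arm al u) + (\<Sum>u\<in>{u \<in> ?N. \<not> is_descent F u}. arm al u)"
    proof -
      have "?N = D \<union> {u \<in> ?N. \<not> is_descent F u}" by (auto simp: D_def)
      then have "(\<Sum>u\<in>?N. arm al u) = (\<Sum>u\<in>D \<union> {u \<in> ?N. \<not> is_descent F u}. arm al u)" by simp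
      also have "\<dots> = (\<Sum>u\<in>D. arm al u) + (\<Sum>u\<in>{u \<in> ?N. \<not> is_descent F u}. arm al u)"
        by (rule sum.union_disjoint) (auto simp: D_def finite_nb_boxes)
      finally show ?thesis .
    qed
    have exponent: "(\<Sum>u\<in>?N. arm al u) + coinv al F =
        basement_const sigma al + (\<Sum>u\<in>?N. box_inv n F u) + (\<Sum>u\<in>D. arm al u)"
      using coinv_eq_box_inv[OF F] split by (simp add: n_def)
    have "w F = (\<Prod>u\<in>?N. x (F u)) * (\<Prod>u\<in>?N. t ^ box_inv n F u) *
        (\<Prod>u\<in>?N. wt t (box_wt al q t u) (F (fst u, snd u - 1)) (F u))"
      by (simp add: w_def prod.distrib)
    also have "(\<Prod>u\<in>?N. t ^ box_inv n F u) = t ^ (\<Sum>u\<in>?N. box_inv n F u)"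
      by (simp add: power_sum)
    also have "(\<Prod>u\<in>?N. wt t (box_wt al q t u) (F (fst u, snd u - 1)) (F u)) =
        (\<Prod>u\<in>?N. if is_descent F u then box_wt al q t u else 1) *
        (\<Prod>u\<in>?N. if F u \<noteq> F (fst u, snd u - 1)
          then (1 - t) / (1 - q ^ (1 + leg al u) * t ^ (1 + arm al u)) else 1)"
      unfolding prod.distrib[symmetric]
      by (rule prod.cong) (auto simp: wt_def is_descent_def box_wt_def algebra_simps)
    also have "(\<Prod>u\<in>?N. if F u \<noteq> F (fst u, snd u - 1)
          then (1 - t) / (1 - q ^ (1 + leg al u) * t ^ (1 + arm al u)) else 1) = K"
      unfolding K_def by (rule prod.inter_filter[symmetric, OF finite_nb_boxes])
    also have "(\<Prod>u\<in>?N. if is_descent F u then box_wt al q t u else 1) = (\<Prod>u\<in>D. box_wt al q t u)"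
      unfolding D_def by (rule prod.inter_filter[symmetric, OF finite_nb_boxes])
    also have "\<dots> = q ^ maj al F * t ^ (\<Sum>u\<in>D. arm al u)"
      unfolding box_wt_def prod.distrib maj_def D_def[symmetric] by (simp add: power_sum add.commute)
    finally have wF: "w F = (\<Prod>u\<in>?N. x (F u)) * t ^ (\<Sum>u\<in>?N. box_inv n F u) *
        (q ^ maj al F * t ^ (\<Sum>u\<in>D. arm al u) * K)" .
    have "t ^ (\<Sum>u\<in>?N. arm al u) * ((\<Prod>u\<in>?N. x (F u)) * q ^ maj al F * t ^ coinv al F * K) =
        t ^ ((\<Sum>u\<in>?N. arm al u) + coinv al F) * ((\<Prod>u\<in>?N. x (F u)) * q ^ maj al F * K)"
      by (simp add: power_add)
    also have "\<dots> = t ^ basement_const sigma al * w F"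
      unfolding exponent wF by (simp add: power_add)
    finally show ?thesis by (simp add: K_def)
  qed
  then show ?thesis
    unfolding Emac_def W[unfolded m_def] sum_distrib_left by (intro sum.cong) auto
qed

section \<open>Symmetry\<close>

text \<open>Row \<open>Suc j\<close> counts for row \<open>j\<close>, since the comparison with
  lower rows is weak, but not conversely, since that with upper rows is strict. All other rows
  contribute alike.\<close>

lemma arm_equal_rows:
  assumes "1 \<le> j" "j < length al" "part al j = part al (Suc j)" "c \<le> part al j"
  shows "arm al (j, c) = Suc (arm al (Suc j, c))"
proof -
  have "{r'. j < r' \<and> r' \<le> length al \<and> c \<le> part al r' \<and> part al r' \<le> part al j} =
      insert (Suc j) {r'. Suc j < r' \<and> r' \<le> length al \<and> c \<le> part al r' \<and> part al r' \<le> part al (Suc j)}"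
    using assms by (auto intro: Suc_lessI)
  moreover have "{r'. 1 \<le> r' \<and> r' < j \<and> c - 1 \<le> part al r' \<and> part al r' < part al j} =
      {r'. 1 \<le> r' \<and> r' < Suc j \<and> c - 1 \<le> part al r' \<and> part al r' < part al (Suc j)}"
    using assms by (auto simp: less_Suc_eq)
  ultimately show ?thesis
    by (simp add: arm_eq_fibres)
qed

text \<open>Nonvanishing is assumed only for the exponents of the diagram, because the lemma is
  later applied at values other than the given \<open>t\<close>. A nonzero \<open>t\<close> cancels
  the power in \<open>Emac_eq_W\<close>.\<close>

lemma Emac_symmetric_generic:
  fixes x :: "nat \<Rightarrow> 'a::field_char_0"
  assumes len: "length sigma = length al" and dist: "distinct sigma" and set: "set sigma = {1..length al}"
    and j: "1 \<le> j" "j < length al" and parts: "part al j = part al (Suc j)"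
    and ij: "{sigma ! (j - 1), sigma ! j} = {i, Suc i}"
    and nz: "\<And>u. u \<in> aug_boxes al \<Longrightarrow> 1 - q ^ (1 + leg al u) * t ^ (1 + arm al u) \<noteq> 0"
    and t: "t \<noteq> 0" "t ^ 2 \<noteq> 1"
  shows "Emac sigma al x q t = Emac sigma al (x \<circ> transpose i (Suc i)) q t"
proof -
  define n where "n = length al"
  define p0 where "p0 = n - Suc j"
  let ?y = "\<lambda>p. box_wt al q t (cell n p)"
  interpret S: scan n "in_diagram al" ?y t .
  have p0: "Suc p0 < n" and p0_Suc: "Suc p0 = n - j"
    using j by (auto simp: p0_def n_def)
  have cells: "cell n (p0 + c * n) = (Suc j, c)" "cell n (Suc (p0 + c * n)) = (j, c)" for c
  proof -
    have "p0 + c * n = pos n (Suc j, c)" "Suc (p0 + c * n) = pos n (j, c)"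
      using p0_Suc by (simp_all add: pos_def p0_def)
    then show "cell n (p0 + c * n) = (Suc j, c)" "cell n (Suc (p0 + c * n)) = (j, c)"
      using j by (simp_all add: cell_pos n_def)
  qed
  have i: "1 \<le> i" "Suc i \<le> n"
  proof -
    have "sigma ! (j - 1) \<in> set sigma" "sigma ! j \<in> set sigma"
      using j len by auto
    then have "{i, Suc i} \<subseteq> {1..n}"
      unfolding ij[symmetric] using set by (simp add: n_def)
    then show "1 \<le> i" "Suc i \<le> n" by auto
  qed
  have "S.W x (n * sum_list al) n (basement sigma) =
      S.W (x \<circ> transpose i (Suc i)) (n * sum_list al) n (basement sigma)"
  proof (rule S.W_symmetric[OF i p0])
    show "in_diagram al (Suc (p0 + c * n)) \<longleftrightarrow> in_diagram al (p0 + c * n)" for c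
      using j parts unfolding in_diagram_def n_def[symmetric] cells by (simp add: aug_boxes_def n_def)
    show "?y (Suc (p0 + c * n)) = t * ?y (p0 + c * n)" if "1 \<le> c" "in_diagram al (p0 + c * n)" for c
    proof -
      have "c \<le> part al (Suc j)"
        using that unfolding in_diagram_def n_def[symmetric] cells by (simp add: aug_boxes_def)
      then show ?thesis
        unfolding cells box_wt_def using arm_equal_rows[of j al c] j parts by (simp add: leg_def)
    qed
    show "1 - t * ?y p \<noteq> 0" if "in_diagram al p" for p
      using nz[of "cell n p"] that by (simp add: in_diagram_def n_def box_wt_def algebra_simps)
    show "inj_on (basement sigma) {0..<n}"
    proof (rule inj_onI)
      fix r s assume rs: "r \<in> {0..<n}" "s \<in> {0..<n}" "basement sigma r = basement sigma s"
      then have "sigma ! (n - 1 - r) = sigma ! (n - 1 - s)"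
        using len by (simp add: basement_def n_def)
      moreover have "n - 1 - r < length sigma" "n - 1 - s < length sigma"
        using rs len by (auto simp: n_def)
      ultimately have "n - 1 - r = n - 1 - s"
        using nth_eq_iff_index_eq[OF dist] by blast
      then show "r = s" using rs by auto
    qed
    have "basement sigma p0 = sigma ! j" "basement sigma (Suc p0) = sigma ! (j - 1)"
    proof -
      have "n - 1 - p0 = j" "n - 1 - Suc p0 = j - 1" using j by (auto simp: p0_def n_def)
      then show "basement sigma p0 = sigma ! j" "basement sigma (Suc p0) = sigma ! (j - 1)"
        using p0 len by (simp_all add: basement_def n_def)
    qed
    then show "{basement sigma p0, basement sigma (Suc p0)} = {i, Suc i}"
      using ij by (simp add: insert_commute)
  qed (rule t)
  then have "t ^ (\<Sum>u\<in>nb_boxes al. arm al u) * Emac sigma al x q t =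
      t ^ (\<Sum>u\<in>nb_boxes al. arm al u) * Emac sigma al (x \<circ> transpose i (Suc i)) q t"
    using Emac_eq_W[of al sigma t x q] Emac_eq_W[of al sigma t "x \<circ> transpose i (Suc i)" q] len dist set j
    by (simp add: n_def)
  then show ?thesis
    using t by simp
qed

section \<open>Passage to exceptional values of t by a polynomial identity\<close>

definition Emac_denominator :: "nat list \<Rightarrow> 'a::field \<Rightarrow> 'a poly" where
  "Emac_denominator al q = (\<Prod>u\<in>aug_boxes al. 1 - monom (q ^ (1 + leg al u)) (1 + arm al u))"

text \<open>A nonzero value at \<open>t\<close> yields the nonvanishing hypothesis of
  \<open>Emac_symmetric_generic\<close> for every augmented box at once.\<close>

lemma poly_Emac_denominator:
  "poly (Emac_denominator al q) t = (\<Prod>u\<in>aug_boxes al. 1 - q ^ (1 + leg al u) * t ^ (1 + arm al u))"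
  by (simp add: Emac_denominator_def poly_prod poly_monom)

text \<open>Each filling uses only some factors of the common denominator; the remaining ones pass
  into its numerator.\<close>

lemma Emac_numerator_poly:
  fixes x :: "nat \<Rightarrow> 'a::field"
  obtains N where "\<And>t. poly (Emac_denominator al q) t \<noteq> 0 \<Longrightarrow>
    poly (Emac_denominator al q) t * Emac sigma al x q t = poly N t"
proof
  define U where "U = (\<lambda>F. {u \<in> nb_boxes al. F u \<noteq> (F (fst u, snd u - 1) :: nat)})"
  define d where "d = (\<lambda>u. 1 - monom (q ^ (1 + leg al u)) (1 + arm al u))"
  define N where "N = (\<Sum>F\<in>NAF sigma al. smult ((\<Prod>u\<in>nb_boxes al. x (F u)) * q ^ maj al F)
     (monom 1 (coinv al F) * ((\<Prod>u\<in>U F. [:1, -1:]) * (\<Prod>u\<in>aug_boxes al - U F. d u))))"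
  fix t assume nz: "poly (Emac_denominator al q) t \<noteq> 0"
  have d: "poly (d u) t = 1 - q ^ (1 + leg al u) * t ^ (1 + arm al u)" for u
    by (simp add: d_def poly_monom)
  have D: "poly (Emac_denominator al q) t = (\<Prod>u\<in>aug_boxes al. poly (d u) t)"
    unfolding poly_Emac_denominator d ..
  have cancel: "poly (Emac_denominator al q) t * (\<Prod>u\<in>U F. (1 - t) / poly (d u) t) =
      (\<Prod>u\<in>U F. 1 - t) * (\<Prod>u\<in>aug_boxes al - U F. poly (d u) t)" for F
  proof -
    have sub: "U F \<subseteq> aug_boxes al"
      using nb_subset_aug by (auto simp: U_def)
    have "(\<Prod>u\<in>U F. poly (d u) t) \<noteq> 0"
      using nz sub finite_subset[OF sub finite_aug_boxes]
      by (auto simp: D finite_aug_boxes)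
    moreover have "poly (Emac_denominator al q) t =
        (\<Prod>u\<in>aug_boxes al - U F. poly (d u) t) * (\<Prod>u\<in>U F. poly (d u) t)"
      unfolding D by (rule prod.subset_diff[OF sub finite_aug_boxes])
    ultimately show ?thesis
      by (simp add: prod_dividef)
  qed
  have "poly (Emac_denominator al q) t * Emac sigma al x q t =
      (\<Sum>F\<in>NAF sigma al. (\<Prod>u\<in>nb_boxes al. x (F u)) * q ^ maj al F * t ^ coinv al F *
         (poly (Emac_denominator al q) t * (\<Prod>u\<in>U F. (1 - t) / poly (d u) t)))"
    unfolding Emac_def sum_distrib_left d U_def by (rule sum.cong) (simp_all add: ac_simps)
  also have "\<dots> = poly N t"
    unfolding cancel N_def poly_sum by (rule sum.cong) (simp_all add: poly_monom poly_prod ac_simps)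
  finally show "poly (Emac_denominator al q) t * Emac sigma al x q t = poly N t" .
qed

theorem mainTheorem8:
  fixes al sigma :: "nat list" and j i :: nat
    and x :: "nat \<Rightarrow> 'a::field_char_0" and q t :: 'a
  assumes "length sigma = length al"
    and "distinct sigma" and "set sigma = {1..length al}"
    and "1 \<le> j" and "j \<le> length al - 1"
    and "al ! (j - 1) = al ! j"
    and "{sigma ! (j - 1), sigma ! j} = {i, i + 1}"
    and "\<forall>a b :: nat. 1 \<le> a \<longrightarrow> 1 \<le> b \<longrightarrow> 1 - q ^ a * t ^ b \<noteq> 0"
  shows "Emac sigma al x q t = Emac sigma al (x(i := x (i + 1), i + 1 := x i)) q t"
proof -
  have swap: "x(i := x (i + 1), i + 1 := x i) = x \<circ> transpose i (Suc i)"
    by (auto simp: fun_eq_iff transpose_def)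
  define D where "D = Emac_denominator al q"
  obtain N where N: "\<And>s. poly D s \<noteq> 0 \<Longrightarrow> poly D s * Emac sigma al x q s = poly N s"
    unfolding D_def using Emac_numerator_poly by blast
  obtain N' where N': "\<And>s. poly D s \<noteq> 0 \<Longrightarrow>
      poly D s * Emac sigma al (x \<circ> transpose i (Suc i)) q s = poly N' s"
    unfolding D_def using Emac_numerator_poly by blast
  have generic: "poly N s = poly N' s" if s: "poly D s \<noteq> 0" "s \<noteq> 0" "s ^ 2 \<noteq> 1" for s
  proof -
    have "Emac sigma al x q s = Emac sigma al (x \<circ> transpose i (Suc i)) q s"
    proof (rule Emac_symmetric_generic[where j = j])
      show "1 - q ^ (1 + leg al u) * s ^ (1 + arm al u) \<noteq> 0" if "u \<in> aug_boxes al" for u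
        using s(1) that finite_aug_boxes[of al] by (auto simp: D_def poly_Emac_denominator)
    qed (use assms s in \<open>auto simp: Defs.part_def\<close>)
    then show ?thesis
      using N[OF s(1)] N'[OF s(1)] by simp
  qed
  \<comment> \<open>Every factor carries a positive power of the variable, so the constant term is 1
    and \<open>D\<close> is a nonzero polynomial.\<close>
  have "poly D 0 = 1"
    by (simp add: D_def poly_Emac_denominator)
  then have "D \<noteq> 0" by auto
  \<comment> \<open>The extra factors \<open>D\<close>, \<open>s\<close> and
    \<open>s ^ 2 - 1\<close> vanish at the excluded values, so the product vanishes everywhere and,
    over an infinite field, is the zero polynomial.\<close>
  have "poly ((N - N') * (D * ([:0, 1:] * [:-1, 0, 1:]))) s = 0" for s
    using generic[of s] by (auto simp: power2_eq_square)
  then have "(N - N') * (D * ([:0, 1:] * [:-1, 0, 1:])) = 0"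
    using poly_all_0_iff_0 by blast
  moreover have "[:0, 1:] * [:-1, 0, 1:] \<noteq> (0 :: 'a poly)" by simp
  ultimately have "N = N'"
    using \<open>D \<noteq> 0\<close> by (metis mult_eq_0_iff right_minus_eq)
  moreover have t: "poly D t \<noteq> 0"
    using assms(8) by (simp add: D_def poly_Emac_denominator finite_aug_boxes del: power_Suc)
  ultimately show ?thesis
    using N[OF t] N'[OF t] unfolding swap by (metis mult_left_cancel)
qed

end
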